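(* Consider the infinite Schreier graphs $\Gamma_\xi$, $\xi\in\{0,1\}^\omega$, of the Basilica group $B$, up to isomorphism of unrooted, unlabeled graphs. Each isomorphism class is regarded as the set of all $\xi\in\{0,1\}^{\omega}$ whose graph $\Gamma_\xi$ lies in it, which is a union of $B$-orbits. Then: (1) There is exactly one isomorphism class of 4-ended graphs $\Gamma_\xi$, and it contains a single $B$-orbit. (2) There are uncountably many isomorphism classes of 2-ended graphs $\Gamma_\xi$, and each of these classes contains exactly two $B$-orbits. (3) There are uncountably many isomorphism classes of 1-ended graphs $\Gamma_\xi$. The isomorphism class of $\Gamma_{1^\omega}$ is a single $B$-orbit, and every other isomorphism class of 1-ended graphs contains uncountably many $B$-orbits.
   Context: $\{0,1\}^\omega$ is the set of right-infinite binary words. The Basilica group $B=\langle a,b\rangle$ is the group of automorphisms of the rooted binary tree generated by $a,b$ acting on finite and infinite binary words by $a(0w)=0\,b(w)$, $a(1w)=1w$, $b(0w)=1\,a(w)$, $b(1w)=0w$. For $\xi\in\{0,1\}^\omega$, the Schreier graph $\Gamma_\xi$ is the undirected multigraph whose vertex set is the orbit $B\cdot\xi$, with, for every vertex $x$ and every $s\in\{a,b\}$, one edge joining $x$ and $s(x)$ (a loop if $s(x)=x$; parallel edges are allowed). Labels on edges are forgotten. An end of an infinite graph is an equivalence class of rays, two rays being equivalent if for every finite vertex set $S$ both have a tail in the same connected component of the complement of $S$. *)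

theory Defs
  imports
    "HOL-Algebra.Algebra"
    "HOL-Library.Stream"
    "HOL-Library.Countable_Set"
begin

section \<open>The Basilica group\<close>

text \<open>Right-infinite binary words are streams of booleans, with 0 = False and 1 = True.\<close>

type_synonym binword = "bool stream"

datatype gen = gen_a | gen_b

primcorec act :: "gen \<Rightarrow> binword \<Rightarrow> binword" where
  "act s x =
    (if s = gen_a
     then if shd x then x else False ## act gen_b (stl x)
     else if shd x then False ## stl x else True ## act gen_a (stl x))"

lemma act_SCons [simp]:
  "act gen_a (False ## w) = False ## act gen_b w"
  "act gen_a (True ## w) = True ## w"
  "act gen_b (False ## w) = True ## act gen_a w"
  "act gen_b (True ## w) = False ## w"
  by (subst act.code; simp)+

context
begin

private primcorec inv_act :: "gen \<Rightarrow> binword \<Rightarrow> binword" where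
  "inv_act s x =
    (if s = gen_a
     then if shd x then x else False ## inv_act gen_b (stl x)
     else if shd x then False ## inv_act gen_a (stl x) else True ## stl x)"

private lemma inv_act_snth: "inv_act s (act s x) !! n = x !! n \<and> act s (inv_act s x) !! n = x !! n"
proof (induction n arbitrary: s x)
  case 0
  show ?case by (cases s) auto
next
  case (Suc n)
  then show ?case by (cases s) auto
qed

lemma bij_act: "bij (act s)"
proof (rule o_bij)
  have eqI: "x = y" if "\<And>n. x !! n = y !! n" for x y :: binword
    using that smap_alt[of id x y] by (simp add: stream.map_id)
  show "inv_act s \<circ> act s = id" "act s \<circ> inv_act s = id"
    using inv_act_snth by (auto simp: fun_eq_iff intro: eqI)
qed

end

lemma act_in_carrier: "act s \<in> carrier (BijGroup UNIV)"
  using bij_act by (auto simp: BijGroup_def Bij_def)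

text \<open>
  Automorphisms of the rooted binary tree are identified with the permutations they induce on
  the infinite words; this action is faithful.  Since \<open>subgroup_generated\<close> drops generators
  outside the ambient group, \<open>act_in_carrier\<close> is needed to see that none is lost.
\<close>

definition basilica :: "(binword \<Rightarrow> binword) monoid" where
  "basilica = subgroup_generated (BijGroup UNIV) {act gen_a, act gen_b}"

abbreviation orb :: "binword \<Rightarrow> binword set" where
  "orb \<equiv> orbit basilica (\<lambda>g. g)"


section \<open>Undirected multigraphs\<close>

text \<open>An edge with endpoints \<open>u\<close> and \<open>v\<close> has endpoint set \<open>{u, v}\<close>, a singleton for a loop.\<close>

record ('v, 'e) multigraph =
  verts :: "'v set"
  edges :: "'e set"
  endpoints :: "'e \<Rightarrow> 'v set"

definition isomorphic :: "('v, 'e) multigraph \<Rightarrow> ('w, 'f) multigraph \<Rightarrow> bool" where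
  "isomorphic G H \<longleftrightarrow>
    (\<exists>f h. bij_betw f (verts G) (verts H) \<and> bij_betw h (edges G) (edges H) \<and>
           (\<forall>e\<in>edges G. endpoints H (h e) = f ` endpoints G e))"

definition adjacent :: "('v, 'e) multigraph \<Rightarrow> 'v \<Rightarrow> 'v \<Rightarrow> bool" where
  "adjacent G u v \<longleftrightarrow> (\<exists>e\<in>edges G. endpoints G e = {u, v})"

definition delete_verts :: "('v, 'e) multigraph \<Rightarrow> 'v set \<Rightarrow> ('v, 'e) multigraph" where
  "delete_verts G S =
    \<lparr>verts = verts G - S, edges = {e\<in>edges G. endpoints G e \<inter> S = {}}, endpoints = endpoints G\<rparr>"

definition graph_components :: "('v, 'e) multigraph \<Rightarrow> 'v set set" where
  "graph_components G =
    verts G // {(u, v). u \<in> verts G \<and> v \<in> verts G \<and> (adjacent G)\<^sup>*\<^sup>* u v}"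

text \<open>
  A ray is given by its sequence of vertices; which of several parallel edges it uses does not
  affect the end it belongs to.
\<close>

definition rays :: "('v, 'e) multigraph \<Rightarrow> (nat \<Rightarrow> 'v) set" where
  "rays G = {r. range r \<subseteq> verts G \<and> inj r \<and> (\<forall>n. adjacent G (r n) (r (Suc n)))}"

definition end_rel :: "('v, 'e) multigraph \<Rightarrow> ((nat \<Rightarrow> 'v) \<times> (nat \<Rightarrow> 'v)) set" where
  "end_rel G =
    {(r, s). r \<in> rays G \<and> s \<in> rays G \<and>
       (\<forall>S. finite S \<and> S \<subseteq> verts G \<longrightarrow>
          (\<exists>C\<in>graph_components (delete_verts G S).
             (\<exists>m. \<forall>n\<ge>m. r n \<in> C) \<and> (\<exists>m. \<forall>n\<ge>m. s n \<in> C)))}"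

definition graph_ends :: "('v, 'e) multigraph \<Rightarrow> (nat \<Rightarrow> 'v) set set" where
  "graph_ends G = rays G // end_rel G"

text \<open>For positive \<open>k\<close>, the only case used, \<open>card\<close> also forces the set of ends to be finite.\<close>

definition ended :: "nat \<Rightarrow> ('v, 'e) multigraph \<Rightarrow> bool" where
  "ended k G \<longleftrightarrow> card (graph_ends G) = k"


section \<open>Schreier graphs and their isomorphism classes\<close>

definition schreier :: "binword \<Rightarrow> (binword, binword \<times> gen) multigraph" where
  "schreier \<xi> =
    \<lparr>verts = orb \<xi>, edges = orb \<xi> \<times> UNIV, endpoints = (\<lambda>(x, s). {x, act s x})\<rparr>"

definition iso_class :: "binword \<Rightarrow> binword set" where
  "iso_class \<xi> = {\<eta>. isomorphic (schreier \<xi>) (schreier \<eta>)}"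

definition ended_classes :: "nat \<Rightarrow> binword set set" where
  "ended_classes k = iso_class ` {\<xi>. ended k (schreier \<xi>)}"

definition orbits_in :: "binword set \<Rightarrow> binword set set" where
  "orbits_in C = {A \<in> orbits basilica UNIV (\<lambda>g. g). A \<subseteq> C}"


lemma action_basilica: "group_action basilica UNIV (\<lambda>g. g)"
proof -
  interpret G: group "BijGroup (UNIV :: binword set)"
    by (rule group_BijGroup)
  have "group basilica"
    by (simp add: basilica_def)
  moreover have "(\<lambda>g. g) \<in> hom basilica (BijGroup UNIV)"
    using G.carrier_subgroup_generated_subset by (auto simp: hom_def basilica_def)
  ultimately show ?thesis
    by (simp add: group_action_def group_hom_def group_hom_axioms_def)
qed

lemma orb_eq: "\<eta> \<in> orb \<xi> \<Longrightarrow> orb \<eta> = orb \<xi>"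
  using group_action.orbit_sym[OF action_basilica] group_action.orbit_trans[OF action_basilica]
  by blast

lemma iso_class_Union_orbits: "iso_class \<xi> = \<Union> (orbits_in (iso_class \<xi>))"
proof -
  have "orb \<eta> \<subseteq> iso_class \<xi>" if "\<eta> \<in> iso_class \<xi>" for \<eta>
    using that orb_eq[of _ \<eta>] by (auto simp: iso_class_def schreier_def)
  moreover have "\<eta> \<in> orb \<eta>" for \<eta>
    using group_action.orbit_refl[OF action_basilica] by blast
  ultimately show ?thesis
    by (fastforce simp: orbits_in_def orbits_def)
qed

end

theory Submission
  imports Defs
begin

text \<open>
Every vertex lies on one \<open>a\<close>-cycle and one \<open>b\<close>-cycle, and the Schreier graph is a cactus of
these cycles. On words \<open>0 i\<^sub>1 0 i\<^sub>2 \<dots>\<close> the generator \<open>a\<close> subtracts one, with borrow, from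
the 2-adic integer with digits \<open>i\<^sub>1 i\<^sub>2 \<dots>\<close>, and a letter \<open>1\<close> at an even position cuts this
odometer off: the digits before it are counted cyclically and nothing behind it is touched.
So the \<open>a\<close>-cycle of a word is infinite if all its even positions are \<open>0\<close>, and otherwise has
length \<open>2\<^sup>k\<close>, where \<open>2k\<close> is the first even position with a \<open>1\<close>; the \<open>b\<close>-cycle of \<open>i w\<close> is
twice as long as the \<open>a\<close>-cycle of \<open>w\<close>. Orbits are of three kinds: all cycles are finite
(infinitely many \<open>1\<close>s at even and at odd positions); there is an infinite cycle; or the
orbit is that of \<open>0\<^sup>\<omega>\<close>, where an infinite \<open>a\<close>-cycle and an infinite \<open>b\<close>-cycle cross. These
have one, two and four ends.

The number of ends is found by self-similarity. The words of an orbit with the same tail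
after \<open>n\<close> letters form a finite connected tile, and contracting the tiles gives, up to loops
and labels, the Schreier graph of the tail \<open>t\<close>. Hence (\<open>lift_path_within\<close>) deleting the tile
of \<open>t\<close> leaves no more pieces than deleting the vertex \<open>t\<close> from its own Schreier graph. If
\<open>t\<close> begins with \<open>1\<close>, then \<open>a\<close> fixes it, and its only neighbours are its two \<open>b\<close>-neighbours,
which are joined around their \<open>b\<close>-cycle when that is finite. Outside the orbit of \<open>0\<^sup>\<omega>\<close> this
bounds the number of ends by two, and by one if all cycles are finite. For the lower bounds,
\<open>attach\<close> retracts the graph onto an infinite \<open>a\<close>-cycle and is constant along every edge off
that cycle, so each vertex of the cycle separates its two sides.

Isomorphisms are rigid enough to be followed letter by letter. Loops sit exactly at the
words beginning with \<open>1\<close>, and \<open>b\<close>-edges are those along which the first letter changes; an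
isomorphism of unlabelled graphs therefore keeps first letters and labels and can only
reverse cycles. Its restriction to words beginning with \<open>0\<close> is again an isomorphism, between
the Schreier graphs of the tails (\<open>label_iso_stl\<close>). Conversely, the maps \<open>twist f\<close> reverse
exactly those finite cycles whose odometer is cut off at a position chosen by \<open>f\<close>. An
infinite cycle allows just one choice, so the image of one of its vertices is the vertex
itself or its image under the map \<open>tau\<close> that reverses all cycles (\<open>label_iso_a_line\<close>); these
lie in different orbits unless the orbit is that of \<open>0\<^sup>\<omega>\<close>. The word \<open>1\<^sup>\<omega>\<close> is fixed by every
isomorphism that is defined there, because \<open>a\<close> fixes the tail behind each of its letters and
so no reversal moves it. For every other word with only finite cycles, outside the orbit of
\<open>1\<^sup>\<omega>\<close>, infinitely many reversals matter, and a diagonal argument gives uncountably many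
images (\<open>uncountable_twists\<close>). Since orbits are countable, uncountably many vertices mean
uncountably many orbits.
\<close>

section \<open>Generators and orbits\<close>

lemma stream_eqI: "(\<And>n. x !! n = y !! n) \<Longrightarrow> x = y"
  by (metis (full_types) ext stream_smap_nats)

definition iact :: "gen \<Rightarrow> binword \<Rightarrow> binword" where
  "iact s = inv_into UNIV (act s)"

lemma act_iact [simp]: "act s (iact s x) = x"
  using bij_act by (simp add: iact_def bij_is_surj surj_f_inv_f)

lemma iact_act [simp]: "iact s (act s x) = x"
  using bij_act by (simp add: iact_def bij_is_inj)

lemma act_eq_iff [simp]: "act s x = act s y \<longleftrightarrow> x = y"
  by (metis iact_act)

lemma act_eq_iff_iact: "act s x = y \<longleftrightarrow> x = iact s y"
  by auto

lemma iact_SCons [simp]: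
  "iact gen_a (False ## w) = False ## iact gen_b w"
  "iact gen_a (True ## w) = True ## w"
  "iact gen_b (False ## w) = True ## w"
  "iact gen_b (True ## w) = False ## iact gen_a w"
  by (metis act_SCons act_iact iact_act)+

lemma shd_act_a [simp]: "shd (act gen_a x) = shd x" "shd (iact gen_a x) = shd x"
  by (cases x; cases "shd x"; simp)+

lemma shd_act_b [simp]: "shd (act gen_b x) = (\<not> shd x)" "shd (iact gen_b x) = (\<not> shd x)"
  by (cases x; cases "shd x"; simp)+

lemma act_a_fixed_iff: "act gen_a x = x \<longleftrightarrow> shd x"
proof (cases x)
  case (SCons i w)
  have "act gen_b w \<noteq> w" by (metis shd_act_b(1))
  then show ?thesis using SCons by (cases i) auto
qed

definition step :: "binword \<Rightarrow> binword \<Rightarrow> bool" where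
  "step u v \<longleftrightarrow> (\<exists>s. v = act s u \<or> u = act s v)"

lemma step_sym: "step u v \<Longrightarrow> step v u"
  by (auto simp: step_def)

lemma step_act: "step x (act s x)" "step x (iact s x)" "step (act s x) x" "step (iact s x) x"
  by (auto simp: step_def) (metis act_iact)+

lemma stepE:
  assumes "step u v" obtains s where "v = act s u" | s where "v = iact s u"
  using assms unfolding step_def by (metis iact_act)

text \<open>
The relation is reflexive also at vertices outside \<open>U\<close>.
\<close>

definition path_within :: "binword set \<Rightarrow> binword \<Rightarrow> binword \<Rightarrow> bool" where
  "path_within U = rtranclp (\<lambda>u v. step u v \<and> u \<in> U \<and> v \<in> U)"

lemma path_within_refl [simp]: "path_within U u u"
  by (simp add: path_within_def)

lemma path_within_trans [trans]: "path_within U u v \<Longrightarrow> path_within U v w \<Longrightarrow> path_within U u w"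
  by (simp add: path_within_def)

lemma path_within_sym: "path_within U u v \<Longrightarrow> path_within U v u"
proof -
  have "symp (\<lambda>u v. step u v \<and> u \<in> U \<and> v \<in> U)"
    by (auto intro: sympI step_sym)
  then have "symp (path_within U)"
    unfolding path_within_def by (rule symp_rtranclp)
  then show "path_within U u v \<Longrightarrow> path_within U v u" by (rule sympD)
qed

lemma path_within_step: "step u v \<Longrightarrow> u \<in> U \<Longrightarrow> v \<in> U \<Longrightarrow> path_within U u v"
  unfolding path_within_def by auto

lemma path_within_induct [consumes 1, case_names refl step]:
  assumes "path_within U u v" "P u" "\<And>v w. path_within U u v \<Longrightarrow> step v w \<Longrightarrow> v \<in> U \<Longrightarrow> w \<in> U \<Longrightarrow> P v \<Longrightarrow> P w"
  shows "P v"
  using assms(1) unfolding path_within_def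
  by (induction rule: rtranclp_induct) (use assms(2,3) in \<open>auto simp: path_within_def\<close>)

lemma path_within_mono: "path_within U u v \<Longrightarrow> U \<subseteq> Y \<Longrightarrow> path_within Y u v"
  by (induction rule: path_within_induct) (auto intro: path_within_trans path_within_step)

lemma path_within_mem: "path_within U u v \<Longrightarrow> u \<in> U \<Longrightarrow> v \<in> U"
  by (induction rule: path_within_induct) auto

lemma orb_refl [simp]: "\<xi> \<in> orb \<xi>"
  using group_action.orbit_refl[OF action_basilica] by blast

lemma carrier_basilica: "carrier basilica = generate (BijGroup UNIV) {act gen_a, act gen_b}"
  unfolding basilica_def carrier_subgroup_generated
  using act_in_carrier by (simp add: Int_absorb1)

lemma inv_BijGroup: "bij f \<Longrightarrow> inv\<^bsub>BijGroup UNIV\<^esub> f = inv_into UNIV f"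
  by (rule ext) (simp add: inv_BijGroup Bij_def restrict_def)

text \<open>
Products of generators and their inverses are followed one factor at a time, so an orbit is
a connected component of the relation \<open>step\<close>.
\<close>

lemma orb_path_within: "orb \<xi> = {y. path_within UNIV \<xi> y}"
proof (intro Set.set_eqI iffI)
  fix y assume "y \<in> orb \<xi>"
  then obtain g where g: "g \<in> generate (BijGroup UNIV) {act gen_a, act gen_b}" "y = g \<xi>"
    by (auto simp: orbit_def carrier_basilica)
  have gen: "generate (BijGroup UNIV) {act gen_a, act gen_b} \<subseteq> carrier (BijGroup UNIV)"
    using act_in_carrier by (intro group.generate_incl[OF group_BijGroup]) auto
  have "path_within UNIV x (g x)" for x
    using g(1)
  proof (induction arbitrary: x rule: generate.induct)
    case one
    then show ?case by (simp add: BijGroup_def)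
  next
    case (incl h)
    then show ?case by (auto intro!: path_within_step step_act)
  next
    case (inv h)
    then show ?case using bij_act by (auto simp: inv_BijGroup iact_def[symmetric] intro!: path_within_step step_act)
  next
    case (eng h1 h2)
    then have "h1 \<in> Bij UNIV" "h2 \<in> Bij UNIV"
      using gen by (auto simp: BijGroup_def)
    then have "(h1 \<otimes>\<^bsub>BijGroup UNIV\<^esub> h2) x = h1 (h2 x)"
      by (simp add: BijGroup_def compose_def)
    then show ?case using eng path_within_trans by metis
  qed
  then show "y \<in> {y. path_within UNIV \<xi> y}" using g by simp
next
  fix y assume "y \<in> {y. path_within UNIV \<xi> y}"
  then have "path_within UNIV \<xi> y" by simp
  then show "y \<in> orb \<xi>"
  proof (induction rule: path_within_induct)
    case (step v w)
    have *: "act s x \<in> orb x" for s x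
    proof -
      have "act s \<in> carrier basilica"
        unfolding carrier_basilica by (cases s) (auto intro: generate.incl)
      then show ?thesis by (auto simp: orbit_def)
    qed
    have "w \<in> orb v"
      using step(2) * orb_eq orb_refl unfolding step_def by metis
    then show ?case using step orb_eq by metis
  qed simp
qed

lemma orb_step: "step u v \<Longrightarrow> u \<in> orb \<xi> \<longleftrightarrow> v \<in> orb \<xi>"
  unfolding orb_path_within by (auto intro: path_within_trans path_within_step step_sym)

lemma orb_act [simp]: "act s u \<in> orb \<xi> \<longleftrightarrow> u \<in> orb \<xi>" "iact s u \<in> orb \<xi> \<longleftrightarrow> u \<in> orb \<xi>"
  using orb_step step_act by blast+

lemma orb_induct [consumes 1, case_names refl act iact]:
  assumes "y \<in> orb \<xi>" "P \<xi>" "\<And>s y. y \<in> orb \<xi> \<Longrightarrow> P y \<Longrightarrow> P (act s y)"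
    "\<And>s y. y \<in> orb \<xi> \<Longrightarrow> P y \<Longrightarrow> P (iact s y)"
  shows "P y"
proof -
  have "path_within UNIV \<xi> y" using assms(1) by (simp add: orb_path_within)
  then show ?thesis
    by (induction rule: path_within_induct) (use assms(2-) in \<open>auto simp: orb_path_within elim!: stepE\<close>)
qed

lemma orb_sym: "y \<in> orb x \<Longrightarrow> x \<in> orb y"
  using orb_eq orb_refl by metis

lemma countable_orb: "countable (orb \<xi>)"
proof -
  define f where "f l = foldr (\<lambda>(s, d) y. if d then act s y else iact s y) l \<xi>" for l :: "(gen \<times> bool) list"
  have "y \<in> range f" if "y \<in> orb \<xi>" for y
    using that
  proof (induction rule: orb_induct)
    case refl
    have "f [] = \<xi>" by (simp add: f_def)
    then show ?case by (metis rangeI)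
  next
    case (act s y)
    then obtain l where "y = f l" by auto
    then have "act s y = f ((s, True) # l)" by (simp add: f_def)
    then show ?case by simp
  next
    case (iact s y)
    then obtain l where "y = f l" by auto
    then have "iact s y = f ((s, False) # l)" by (simp add: f_def)
    then show ?case by simp
  qed
  moreover have "(UNIV :: gen set) = {gen_a, gen_b}"
    using gen.exhaust by auto
  then have "finite (UNIV :: gen set)" by (metis finite.emptyI finite.insertI)
  then have "countable (UNIV :: (gen \<times> bool) list set)"
    using countable_lists[of "UNIV :: (gen \<times> bool) set"]
    by (simp add: countable_finite finite_Prod_UNIV lists_UNIV)
  ultimately show ?thesis
    by (meson countable_image countable_subset subsetI)
qed

lemma orb_stl_mono: "u \<in> orb w \<Longrightarrow> i ## u \<in> orb (j ## w)"
proof -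
  have flip: "i ## u \<in> orb x \<longleftrightarrow> False ## u \<in> orb x" for i u x
    using orb_act(1)[of gen_b "True ## u"] by (cases i) auto
  have "False ## u \<in> orb (False ## w)" if "u \<in> orb w"
    using that
  proof (induction rule: orb_induct)
    case (act s y)
    show ?case
    proof (cases s)
      case gen_a
      have "act gen_b (act gen_b (False ## y)) = False ## act s y" using gen_a by simp
      then show ?thesis using act orb_act(1) by metis
    next
      case gen_b
      then show ?thesis using act orb_act(1)[of gen_a "False ## y"] by simp
    qed
  next
    case (iact s y)
    show ?case
    proof (cases s)
      case gen_a
      have "iact gen_b (iact gen_b (False ## y)) = False ## iact s y" using gen_a by simp
      then show ?thesis using iact orb_act(2) by metis
    next
      case gen_b
      then show ?thesis using iact orb_act(2)[of gen_a "False ## y"] by simp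
    qed
  qed simp
  then show "u \<in> orb w \<Longrightarrow> i ## u \<in> orb (j ## w)"
    using flip orb_sym by (metis orb_eq)
qed

lemma orb_stl: "y \<in> orb x \<Longrightarrow> stl y \<in> orb (stl x)"
proof (induction rule: orb_induct)
  case (act s y)
  then show ?case by (cases y; cases s; cases "shd y") auto
next
  case (iact s y)
  then show ?case by (cases y; cases s; cases "shd y") auto
qed simp

text \<open>
Orbits are self-similar because \<open>a\<close> acts on \<open>0 w\<close> as \<open>b\<close> on \<open>w\<close> and \<open>b\<^sup>2\<close> acts on \<open>i w\<close> as
\<open>a\<close> on \<open>w\<close>, while \<open>b\<close> exchanges \<open>1 w\<close> and \<open>0 w\<close>.
\<close>

lemma orb_stl_iff: "stl y \<in> orb (stl x) \<longleftrightarrow> y \<in> orb x"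
  using orb_stl orb_stl_mono[of "stl y" "stl x" "shd y" "shd x"] by auto

lemma orb_sdrop_iff: "sdrop n y \<in> orb (sdrop n x) \<longleftrightarrow> y \<in> orb x"
  by (induction n arbitrary: x y) (auto simp: orb_stl_iff)

section \<open>Lengths of cycles\<close>

text \<open>
Since \<open>a\<close> and \<open>b\<close> exchange roles after one letter, arguments about \<open>a\<close> alone peel off two
letters at a time.
\<close>

lemma stream_coinduct2:
  assumes "P p"
    and step: "\<And>p. P p \<Longrightarrow>
      f p = g p \<or> (\<exists>i j q. f p = i ## j ## f q \<and> g p = i ## j ## g q \<and> P q)"
  shows "f p = g p"
proof (rule stream_eqI)
  fix n show "f p !! n = g p !! n" using \<open>P p\<close>
  proof (induction n arbitrary: p rule: less_induct)
    case (less n)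
    consider "f p = g p" | i j q where "f p = i ## j ## f q" "g p = i ## j ## g q" "P q"
      using step less.prems by blast
    then show ?case
    proof cases
      case 2
      then show ?thesis using less.IH by (cases n; cases "n - 1") auto
    qed simp
  qed
qed

lemma two_letters: obtains i j w where "x = i ## j ## w"
  by (metis stream.exhaust)

definition act_pow :: "gen \<Rightarrow> int \<Rightarrow> binword \<Rightarrow> binword" where
  "act_pow s n x = (if n \<ge> 0 then (act s ^^ nat n) x else (iact s ^^ nat (- n)) x)"

lemma act_pow_0 [simp]: "act_pow s 0 x = x"
  by (simp add: act_pow_def)

lemma act_act_pow: "act s (act_pow s n x) = act_pow s (n + 1) x"
proof (cases "n \<ge> 0")
  case True
  then show ?thesis by (simp add: act_pow_def nat_add_distrib)
next
  case False
  then obtain k where "n = - int (Suc k)"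
    by (metis int_cases not_le of_nat_0_le_iff)
  moreover have "nat (1 + int k) = Suc k" by simp
  ultimately show ?thesis by (cases k) (auto simp: act_pow_def nat_add_distrib)
qed

lemma iact_act_pow: "iact s (act_pow s n x) = act_pow s (n - 1) x"
  using act_act_pow[of s "n - 1" x] by (metis diff_add_cancel iact_act)

lemma act_pow_1 [simp]: "act_pow s 1 x = act s x" "act_pow s (- 1) x = iact s x"
  using act_act_pow[of s 0 x] iact_act_pow[of s 0 x] by auto

lemma int_step_induct [case_names zero succ pred]:
  assumes "P 0" "\<And>n :: int. P n \<Longrightarrow> P (n + 1)" "\<And>n. P n \<Longrightarrow> P (n - 1)"
  shows "P n"
  by (induction n rule: int_induct[of _ 0]) (use assms in auto)

lemma act_pow_add: "act_pow s m (act_pow s n x) = act_pow s (m + n) x"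
proof (induction m rule: int_step_induct)
  case (succ m)
  then have "act s (act_pow s m (act_pow s n x)) = act s (act_pow s (m + n) x)" by simp
  then show ?case by (simp add: act_act_pow algebra_simps)
next
  case (pred m)
  then have "iact s (act_pow s m (act_pow s n x)) = iact s (act_pow s (m + n) x)" by simp
  then show ?case by (simp add: iact_act_pow algebra_simps)
qed simp

lemma act_pow_eq_iff: "act_pow s m x = act_pow s n x \<longleftrightarrow> act_pow s (m - n) x = x"
proof
  assume "act_pow s m x = act_pow s n x"
  then have "act_pow s (- n) (act_pow s m x) = act_pow s (- n) (act_pow s n x)" by simp
  then show "act_pow s (m - n) x = x" by (simp add: act_pow_add)
next
  assume "act_pow s (m - n) x = x"
  then have "act_pow s n (act_pow s (m - n) x) = act_pow s n x" by simp
  then show "act_pow s m x = act_pow s n x" by (simp add: act_pow_add)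
qed

lemma act_pow_orb [simp]: "act_pow s n x \<in> orb y \<longleftrightarrow> x \<in> orb y"
  by (induction n rule: int_step_induct) (simp_all flip: act_act_pow iact_act_pow)

lemma act_pow_a_False: "act_pow gen_a n (False ## w) = False ## act_pow gen_b n w"
  by (induction n rule: int_step_induct) (simp_all flip: act_act_pow iact_act_pow)

text \<open>
The odometer recursion: two \<open>b\<close>-steps on \<open>i w\<close> are one \<open>a\<close>-step on \<open>w\<close>.
\<close>

lemma act_pow_b_even: "act_pow gen_b (2 * n) (i ## w) = i ## act_pow gen_a n w"
proof (induction n rule: int_step_induct)
  case (succ n)
  have "act_pow gen_b (2 * (n + 1)) (i ## w) = act gen_b (act gen_b (act_pow gen_b (2 * n) (i ## w)))"
    by (simp add: act_act_pow algebra_simps)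
  also have "\<dots> = i ## act gen_a (act_pow gen_a n w)"
    unfolding succ by (cases i) auto
  finally show ?case by (simp add: act_act_pow)
next
  case (pred n)
  have "act_pow gen_b (2 * (n - 1)) (i ## w) = iact gen_b (iact gen_b (act_pow gen_b (2 * n) (i ## w)))"
    by (simp add: iact_act_pow algebra_simps)
  also have "\<dots> = i ## iact gen_a (act_pow gen_a n w)"
    unfolding pred by (cases i) auto
  finally show ?case by (simp add: iact_act_pow)
qed simp

lemma act_pow_a_even: "act_pow gen_a (2 * n) (False ## i ## w) = False ## i ## act_pow gen_a n w"
  by (simp add: act_pow_a_False act_pow_b_even)

lemma shd_act_pow_b: "shd (act_pow gen_b n x) = (shd x \<noteq> odd n)"
  by (induction n rule: int_step_induct) (auto simp flip: act_act_pow iact_act_pow)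

text \<open>
\<open>cycle_rank k x\<close> says that the first \<open>1\<close> at an even position of \<open>x\<close> is at position \<open>2k\<close>; on
the \<open>k\<close> digits at the odd positions before it \<open>a\<close> acts as subtraction of one modulo \<open>2\<^sup>k\<close>,
so that the \<open>a\<close>-cycle of \<open>x\<close> has length \<open>2\<^sup>k\<close>.
\<close>

primrec cycle_rank :: "nat \<Rightarrow> binword \<Rightarrow> bool" where
  "cycle_rank 0 x = shd x"
| "cycle_rank (Suc k) x = (\<not> shd x \<and> cycle_rank k (stl (stl x)))"

definition a_line :: "binword \<Rightarrow> bool" where
  "a_line x \<longleftrightarrow> (\<forall>k. \<not> cycle_rank k x)"

lemma a_line_SCons2 [simp]: "a_line (i ## j ## w) \<longleftrightarrow> \<not> i \<and> a_line w"
proof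
  assume *: "a_line (i ## j ## w)"
  have "\<not> cycle_rank k w" for k
    using *[unfolded a_line_def, rule_format, of 0] *[unfolded a_line_def, rule_format, of "Suc k"] by simp
  moreover have "\<not> i"
    using *[unfolded a_line_def, rule_format, of 0] by simp
  ultimately show "\<not> i \<and> a_line w" by (simp add: a_line_def)
next
  assume *: "\<not> i \<and> a_line w"
  have "\<not> cycle_rank k (i ## j ## w)" for k
    using * by (cases k) (auto simp: a_line_def)
  then show "a_line (i ## j ## w)" by (simp add: a_line_def)
qed

lemma a_lineE:
  assumes "a_line x" obtains j w where "x = False ## j ## w" "a_line w"
  using assms by (cases x rule: two_letters) auto

lemma cycle_rank_act_a [simp]: "cycle_rank k (act gen_a x) = cycle_rank k x"
proof (induction k arbitrary: x)
  case (Suc k)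
  obtain i j w where "x = i ## j ## w" by (rule two_letters)
  then show ?case using Suc by (cases i; cases j) auto
qed simp

lemma cycle_rank_iact_a [simp]: "cycle_rank k (iact gen_a x) = cycle_rank k x"
  using cycle_rank_act_a[of k "iact gen_a x"] by simp

lemma a_line_act_a [simp]: "a_line (act gen_a x) = a_line x" "a_line (iact gen_a x) = a_line x"
  by (simp_all add: a_line_def)

lemma a_line_act_pow_a [simp]: "a_line (act_pow gen_a n x) = a_line x"
  by (induction n rule: int_step_induct) (simp_all flip: act_act_pow iact_act_pow)

lemma cycle_rank_period: "cycle_rank k x \<Longrightarrow> act_pow gen_a (2 ^ k) x = x"
proof (induction k arbitrary: x)
  case 0
  then show ?case by (simp add: act_a_fixed_iff)
next
  case (Suc k)
  obtain i j w where "x = i ## j ## w" by (rule two_letters)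
  then show ?case using Suc by (auto simp: act_pow_a_even)
qed

text \<open>
Descent: an odd power of \<open>a\<close> changes the second letter, and an even power \<open>2m\<close> acts on the
tail after two letters as the power \<open>m\<close>.
\<close>

lemma a_line_free: "a_line x \<Longrightarrow> act_pow gen_a n x = x \<Longrightarrow> n = 0"
proof (induction "nat \<bar>n\<bar>" arbitrary: n x rule: less_induct)
  case less
  obtain j w where x: "x = False ## j ## w" "a_line w"
    using less.prems(1) by (rule a_lineE)
  have "act_pow gen_b n (j ## w) = j ## w"
    using less.prems(2) x by (simp add: act_pow_a_False)
  then have "even n" using shd_act_pow_b[of n "j ## w"] by auto
  then obtain m where m: "n = 2 * m" by blast
  have "act_pow gen_a m w = w"
    using less.prems(2) x m by (simp add: act_pow_a_even)
  moreover have "nat \<bar>m\<bar> < nat \<bar>n\<bar>" if "m \<noteq> 0" using that m by arith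
  ultimately show ?case
    using less.hyps[of m w] m x by (cases "m = 0") auto
qed

text \<open>
The letter that cuts the odometer off and everything behind it stay fixed.
\<close>

lemma cycle_rank_cofinal: "cycle_rank k x \<Longrightarrow> sdrop (2 * k) (act gen_a x) = sdrop (2 * k) x"
proof (induction k arbitrary: x)
  case 0
  then show ?case by (simp add: act_a_fixed_iff)
next
  case (Suc k)
  obtain i j w where "x = i ## j ## w" by (rule two_letters)
  then show ?case using Suc by (cases j) auto
qed

text \<open>
If no tail of \<open>x\<close> lies on an infinite \<open>a\<close>-cycle, then no vertex in the orbit of \<open>x\<close> lies on
an infinite cycle of either kind, because cycles at \<open>x\<close> come from \<open>a\<close>-cycles of tails.
\<close>

definition finite_cycles :: "binword \<Rightarrow> bool" where
  "finite_cycles x \<longleftrightarrow> (\<forall>n. \<exists>k. cycle_rank k (sdrop n x))"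

lemma finite_cycles_stl [simp]: "finite_cycles (stl x) \<longleftrightarrow> finite_cycles x"
proof
  show "finite_cycles x \<Longrightarrow> finite_cycles (stl x)"
    unfolding finite_cycles_def by (metis sdrop.simps(2))
  assume fin: "finite_cycles (stl x)"
  then obtain k where "cycle_rank k (stl (stl x))"
    unfolding finite_cycles_def by (metis sdrop.simps)
  then have "\<exists>k. cycle_rank k x"
    by (metis cycle_rank.simps)
  then show "finite_cycles x"
    unfolding finite_cycles_def
  proof (intro allI)
    fix n show "\<exists>k. cycle_rank k (sdrop n x)"
      using fin \<open>\<exists>k. cycle_rank k x\<close> unfolding finite_cycles_def by (cases n) auto
  qed
qed

lemma finite_cycles_SCons [simp]: "finite_cycles (i ## w) \<longleftrightarrow> finite_cycles w"
  using finite_cycles_stl[of "i ## w"] by simp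

lemma finite_cycles_sdrop [simp]: "finite_cycles (sdrop n x) \<longleftrightarrow> finite_cycles x"
  by (induction n arbitrary: x) auto

lemma finite_cycles_cycle_rank: "finite_cycles x \<Longrightarrow> \<exists>k. cycle_rank k x"
  unfolding finite_cycles_def by (metis sdrop.simps(1))

lemma finite_cycles_act_a [simp]: "finite_cycles (act gen_a x) \<longleftrightarrow> finite_cycles x"
proof -
  have "\<exists>n. sdrop n (act gen_a x) = sdrop n x" if "\<exists>k. cycle_rank k x"
    using that cycle_rank_cofinal by blast
  then show ?thesis
    by (metis cycle_rank_act_a finite_cycles_cycle_rank finite_cycles_sdrop)
qed

lemma finite_cycles_act [simp]: "finite_cycles (act s x) \<longleftrightarrow> finite_cycles x"
proof (cases s)
  case gen_b
  then show ?thesis by (cases x; cases "shd x") auto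
qed simp

lemma finite_cycles_iact [simp]: "finite_cycles (iact s x) \<longleftrightarrow> finite_cycles x"
  using finite_cycles_act[of s "iact s x"] by simp

lemma finite_cycles_orb: "y \<in> orb x \<Longrightarrow> finite_cycles y \<longleftrightarrow> finite_cycles x"
  by (induction rule: orb_induct) auto

lemma sconst_SCons: "sconst c = c ## sconst c"
  by (metis siterate.code id_apply)

lemma a_line_zeros [simp]: "a_line (sconst False)"
  unfolding a_line_def
proof
  fix k show "\<not> cycle_rank k (sconst False)"
    by (induction k) auto
qed

lemma eq_zerosI:
  assumes "R x" "\<And>x. R x \<Longrightarrow> \<not> shd x \<and> R (stl x)"
  shows "x = sconst False"
proof (rule stream_eqI)
  fix n show "x !! n = sconst False !! n" using assms(1)
    by (induction n arbitrary: x) (use assms(2) in auto)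
qed

section \<open>Orbits and tails\<close>

text \<open>
A generator alters infinitely many letters only if the borrow never stops, that is, only at
\<open>0\<^sup>\<omega>\<close>.
\<close>

lemma act_cofinal: "x = sconst False \<or> (\<exists>n. sdrop n (act s x) = sdrop n x)"
proof (rule disjCI)
  assume "\<not> (\<exists>n. sdrop n (act s x) = sdrop n x)"
  then have "\<exists>s. \<forall>n. sdrop n (act s x) \<noteq> sdrop n x" by auto
  then show "x = sconst False"
  proof (rule eq_zerosI[of "\<lambda>x. \<exists>s. \<forall>n. sdrop n (act s x) \<noteq> sdrop n x"])
    fix x assume "\<exists>s. \<forall>n. sdrop n (act s x) \<noteq> sdrop n x"
    then obtain s where s: "sdrop n (act s x) \<noteq> sdrop n x" for n by auto
    obtain i w where x: "x = i ## w" by (cases x)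
    have s': "sdrop n (stl (act s x)) \<noteq> sdrop n (stl x)" for n
      using s[of "Suc n"] by simp
    then show "\<not> shd x \<and> (\<exists>s. \<forall>n. sdrop n (act s (stl x)) \<noteq> sdrop n (stl x))"
      using s[of "Suc 0"] x by (cases s; cases i) auto
  qed
qed

lemma sdrop_eq_trans:
  assumes "sdrop m u = sdrop m v" "sdrop n v = sdrop n w"
  shows "sdrop (m + n) u = sdrop (m + n) w"
proof -
  have "sdrop (m + n) u = sdrop n (sdrop m v)" using assms(1) by (simp flip: sdrop_add)
  also have "\<dots> = sdrop m (sdrop n v)" by (simp only: sdrop_add add.commute)
  also have "\<dots> = sdrop (m + n) w" unfolding assms(2) by (simp only: sdrop_add add.commute)
  finally show ?thesis .
qed

text \<open>
Every step keeps a tail, because the only word at which a generator alters infinitely many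
letters is not in the orbit.
\<close>

lemma orb_cofinal:
  assumes "y \<in> orb x" "sconst False \<notin> orb x"
  shows "\<exists>n. sdrop n y = sdrop n x"
  using assms(1)
proof (induction rule: orb_induct)
  case (act s y)
  then obtain n where n: "sdrop n y = sdrop n x" by blast
  from act have "y \<noteq> sconst False" using assms by auto
  then obtain m where "sdrop m (act s y) = sdrop m y" using act_cofinal by blast
  then show ?case using n sdrop_eq_trans by blast
next
  case (iact s y)
  then obtain n where n: "sdrop n y = sdrop n x" by blast
  from iact have "iact s y \<noteq> sconst False" using assms by (metis orb_act(2))
  then obtain m where "sdrop m (act s (iact s y)) = sdrop m (iact s y)" using act_cofinal by blast
  then have "sdrop m (iact s y) = sdrop m y" by simp
  then show ?case using n sdrop_eq_trans by blast
qed auto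

lemma cofinal_orb: "sdrop n y = sdrop n x \<Longrightarrow> y \<in> orb x"
  using orb_sdrop_iff[of n y x] by simp

section \<open>Branches of an infinite cycle\<close>

text \<open>
\<open>attach gen_a y\<close> is the point at which the branch containing \<open>y\<close> is attached to an infinite
\<open>a\<close>-cycle, and \<open>attach gen_b y\<close> does the same for infinite \<open>b\<close>-cycles. A word \<open>u j v\<close> whose
tail \<open>v\<close> is on an infinite \<open>a\<close>-cycle is attached where all letters of \<open>u\<close> are \<open>0\<close>, if the
length of \<open>u\<close> is odd and minimal. If there is no such tail the recursion yields \<open>0\<^sup>\<omega>\<close>, which
is the right point for the branches hanging on the \<open>b\<close>-line through \<open>0\<^sup>\<omega>\<close>.
\<close>

primcorec attach :: "gen \<Rightarrow> binword \<Rightarrow> binword" where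
  "attach s x =
    (if s = gen_a then False ## attach gen_b (stl x)
     else (shd x \<and> a_line (stl x)) ## (if a_line (stl x) then stl x else attach gen_a (stl x)))"

lemma attach_b: "attach gen_b (j ## w) = (if a_line w then j ## w else False ## attach gen_a w)"
  by (subst attach.code) auto

lemma attach_a: "attach gen_a (i ## j ## w) =
    False ## (if a_line w then j ## w else False ## attach gen_a w)"
  by (subst attach.code) (simp add: attach_b)

lemma attach_a_line: "a_line x \<Longrightarrow> attach gen_a x = x"
  by (erule a_lineE) (simp add: attach_a)

lemma attach_00 [simp]: "attach gen_a (i ## False ## w) = False ## False ## attach gen_a w"
  by (simp add: attach_a attach_a_line)

text \<open>
A \<open>b\<close>-step either affects only letters that \<open>attach\<close> forgets or is passed on to the tail
after two letters.
\<close>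

lemma attach_act_b: "attach gen_a (act gen_b x) = attach gen_a x"
proof (rule stream_coinduct2[where P = "\<lambda>_. True" and f = "\<lambda>x. attach gen_a (act gen_b x)" and g = "\<lambda>x. attach gen_a x"])
  fix x :: binword
  obtain i j w where x: "x = i ## j ## w" by (rule two_letters)
  show "attach gen_a (act gen_b x) = attach gen_a x \<or>
    (\<exists>i j y. attach gen_a (act gen_b x) = i ## j ## attach gen_a (act gen_b y) \<and>
      attach gen_a x = i ## j ## attach gen_a y \<and> True)"
  proof (cases "i \<or> j")
    case True
    then show ?thesis unfolding x by (cases i; cases j) (auto simp: attach_a)
  next
    case False
    then show ?thesis unfolding x
      by (intro disjI2 exI[of _ False] exI[of _ w]) simp
  qed
qed simp

lemma attach_act_a: "\<not> a_line x \<Longrightarrow> attach gen_a (act gen_a x) = attach gen_a x"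
proof (rule stream_coinduct2[where P = "\<lambda>x. \<not> a_line x" and f = "\<lambda>x. attach gen_a (act gen_a x)" and g = "\<lambda>x. attach gen_a x"])
  fix x assume "\<not> a_line x"
  obtain i j w where x: "x = i ## j ## w" by (rule two_letters)
  show "attach gen_a (act gen_a x) = attach gen_a x \<or> (\<exists>i j y. attach gen_a (act gen_a x) = i ## j ## attach gen_a (act gen_a y) \<and>
      attach gen_a x = i ## j ## attach gen_a y \<and> \<not> a_line y)"
  proof (cases "i \<or> j")
    case True
    then show ?thesis using \<open>\<not> a_line x\<close> unfolding x by (cases i; cases j) (auto simp: attach_a)
  next
    case False
    then show ?thesis using \<open>\<not> a_line x\<close> unfolding x
      by (intro disjI2 exI[of _ False] exI[of _ w]) (simp add: attach_a)
  qed
qed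

lemma attach_step:
  assumes "step y z"
  shows "attach gen_a z = attach gen_a y \<or> a_line y \<and> (z = act gen_a y \<or> z = iact gen_a y)"
  using assms
proof (cases rule: stepE)
  case (1 s)
  then show ?thesis by (cases s) (auto simp: attach_act_a attach_act_b)
next
  case (2 s)
  then have "y = act s z" by simp
  then show ?thesis
    using 2 attach_act_a[of z] attach_act_b[of z] by (cases s) (auto simp del: act_iact)
qed

text \<open>
Along a path the attaching point can move only by \<open>a\<close>-steps, and only when the path itself
runs on the line. Hence the positions \<open>n\<close> reachable inside \<open>U\<close> stay in any set \<open>N\<close> closed
under those moves of the line that remain in \<open>U\<close>.
\<close>

lemma attach_path_within:
  assumes "a_line x" and "path_within U y z" and "n \<in> N" "attach gen_a y = act_pow gen_a n x"
    and N: "\<And>n. n \<in> N \<Longrightarrow> act_pow gen_a (n + 1) x \<in> U \<Longrightarrow> n + 1 \<in> N"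
      "\<And>n. n \<in> N \<Longrightarrow> act_pow gen_a (n - 1) x \<in> U \<Longrightarrow> n - 1 \<in> N"
  shows "\<exists>n\<in>N. attach gen_a z = act_pow gen_a n x"
  using assms(2)
proof (induction rule: path_within_induct)
  case refl
  then show ?case using assms by blast
next
  case (step v w)
  then obtain n where n: "n \<in> N" "attach gen_a v = act_pow gen_a n x" by blast
  consider "attach gen_a w = attach gen_a v" | "a_line v" "w = act gen_a v" | "a_line v" "w = iact gen_a v"
    using attach_step[OF step(2)] by blast
  then show ?case
  proof cases
    case 2
    then have w: "w = act_pow gen_a (n + 1) x" using n by (simp add: attach_a_line act_act_pow)
    then have "attach gen_a w = w" using assms(1) by (intro attach_a_line) simp
    moreover have "n + 1 \<in> N" using N(1)[OF n(1)] step(4) w by simp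
    ultimately show ?thesis using w by (intro bexI[of _ "n + 1"]) simp_all
  next
    case 3
    then have w: "w = act_pow gen_a (n - 1) x" using n by (simp add: attach_a_line iact_act_pow)
    then have "attach gen_a w = w" using assms(1) by (intro attach_a_line) simp
    moreover have "n - 1 \<in> N" using N(2)[OF n(1)] step(4) w by simp
    ultimately show ?thesis using w by (intro bexI[of _ "n - 1"]) simp_all
  qed (use n in auto)
qed

text \<open>
The vertex \<open>x\<close> lies on an infinite \<open>s\<close>-cycle and separates its two sides.
\<close>

definition splits :: "gen \<Rightarrow> binword \<Rightarrow> bool" where
  "splits s x \<longleftrightarrow> (\<forall>n. act_pow s n x = x \<longrightarrow> n = 0) \<and>
    (\<forall>m n. m > 0 \<longrightarrow> n < 0 \<longrightarrow> \<not> path_within (- {x}) (act_pow s m x) (act_pow s n x))"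

lemma a_line_side:
  assumes x: "a_line x" and "path_within (- {x}) y z"
    and y: "attach gen_a y = act_pow gen_a m x" and z: "attach gen_a z = act_pow gen_a n x"
  shows "m > 0 \<Longrightarrow> n > 0" "m < 0 \<Longrightarrow> n < 0"
proof -
  have inj: "k = n" if "attach gen_a z = act_pow gen_a k x" for k
    using z that a_line_free[OF x, of "k - n"] by (simp add: act_pow_eq_iff)
  show "n > 0" if "m > 0"
  proof -
    have "\<exists>k\<in>{0<..}. attach gen_a z = act_pow gen_a k x"
    proof (rule attach_path_within[OF assms(1,2) _ y])
      fix k :: int assume "k \<in> {0<..}" "act_pow gen_a (k - 1) x \<in> - {x}"
      then have "k > 0" "k - 1 \<noteq> 0" by (auto simp del: right_minus_eq)
      then show "k - 1 \<in> {0<..}" by simp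
    qed (use that in auto)
    then show ?thesis using inj by auto
  qed
  show "n < 0" if "m < 0"
  proof -
    have "\<exists>k\<in>{..<0}. attach gen_a z = act_pow gen_a k x"
    proof (rule attach_path_within[OF assms(1,2) _ y])
      fix k :: int assume "k \<in> {..<0}" "act_pow gen_a (k + 1) x \<in> - {x}"
      then have "k < 0" "k + 1 \<noteq> 0" by (metis lessThan_iff, metis ComplD act_pow_0 singletonI)
      then show "k + 1 \<in> {..<0}" by simp
    qed (use that in auto)
    then show ?thesis using inj by auto
  qed
qed

lemma a_line_splits: assumes "a_line x" shows "splits gen_a x"
  unfolding splits_def
proof (intro conjI allI impI notI)
  show "n = 0" if "act_pow gen_a n x = x" for n using that assms a_line_free by blast
  fix m n :: int assume "m > 0" "n < 0" "path_within (- {x}) (act_pow gen_a m x) (act_pow gen_a n x)"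
  then show False
    using a_line_side(1)[OF assms, of "act_pow gen_a m x" "act_pow gen_a n x" m n] assms
    by (simp add: attach_a_line)
qed

section \<open>Lifting paths along the self-similarity\<close>

lemma lift_vertical: "stl y \<in> U \<Longrightarrow> stl z = stl y \<Longrightarrow> path_within {y. stl y \<in> U} y z"
proof -
  assume y: "stl y \<in> U" "stl z = stl y"
  have "step (True ## stl y) (False ## stl y)"
    by (metis act_SCons(4) step_act(1))
  then show ?thesis
    using y path_within_step[of "True ## stl y" "False ## stl y" "{y. stl y \<in> U}"]
    by (cases y; cases z; cases "shd y"; cases "shd z") (auto intro: path_within_sym)
qed

text \<open>
Prefixing one letter subdivides the \<open>a\<close>-edges and turns them into \<open>b\<close>-edges, and it turns
\<open>b\<close>-edges into \<open>a\<close>-edges; so paths lift.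
\<close>

lemma lift_path_within_stl:
  assumes "path_within U u v" "u \<in> U" "stl y = u" "stl z = v"
  shows "path_within {y. stl y \<in> U} y z"
proof -
  let ?V = "{y. stl y \<in> U}"
  have *: "path_within ?V (False ## v) (False ## act s v)" if "v \<in> U" "act s v \<in> U" for s v
  proof (cases s)
    case gen_a
    have "path_within ?V (False ## v) (act gen_b (False ## v))"
      using that gen_a by (intro path_within_step step_act) auto
    also have "path_within ?V \<dots> (False ## act s v)"
      using that gen_a by (intro lift_vertical) auto
    finally show ?thesis .
  next
    case gen_b
    then have "False ## act s v = act gen_a (False ## v)" by simp
    then show ?thesis using that by (metis path_within_step mem_Collect_eq step_act(1) stream.sel(2))
  qed
  have "path_within ?V (False ## u) (False ## v)"
    using assms(1)
  proof (induction rule: path_within_induct)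
    case (step v w)
    have "path_within ?V (False ## v) (False ## w)"
      using step(2)
    proof (cases rule: stepE)
      case (1 s)
      then show ?thesis using * step by auto
    next
      case (2 s)
      then show ?thesis using *[of w s] step by (auto intro: path_within_sym)
    qed
    then show ?case using step path_within_trans by blast
  qed simp
  moreover have "v \<in> U" using assms path_within_mem by blast
  ultimately show ?thesis
    using lift_vertical[of y U "False ## u"] lift_vertical[of "False ## v" U z] assms
    by (auto intro: path_within_trans)
qed

text \<open>
The case of equal tails \<open>u = v\<close> says that tiles are connected.
\<close>

lemma lift_path_within:
  assumes "path_within U u v" "u \<in> U" "sdrop n y = u" "sdrop n z = v"
  shows "path_within {y. sdrop n y \<in> U} y z"
  using assms
proof (induction n arbitrary: U u v y z)
  case 0
  then show ?case by simp
next
  case (Suc n)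
  have "path_within {y. sdrop n y \<in> U} (stl y) (stl z)"
    using Suc.prems by (intro Suc.IH) auto
  then have "path_within {y. stl y \<in> {y. sdrop n y \<in> U}} y z"
    using Suc.prems by (intro lift_path_within_stl) auto
  then show ?case by simp
qed

text \<open>
A path between the two sides of a \<open>b\<close>-line would lift to a path between the sides of an
\<open>a\<close>-line.
\<close>

lemma a_line_splits_b:
  assumes "a_line (False ## w)"
  shows "splits gen_b w"
  unfolding splits_def
proof (intro conjI allI impI notI)
  have a: "splits gen_a (False ## w)" using assms by (rule a_line_splits)
  show "n = 0" if "act_pow gen_b n w = w" for n
    using a that unfolding splits_def act_pow_a_False by auto
  fix m n :: int assume mn: "m > 0" "n < 0" "path_within (- {w}) (act_pow gen_b m w) (act_pow gen_b n w)"
  have "act_pow gen_b m w \<noteq> w" using a mn(1) unfolding splits_def act_pow_a_False by fastforce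
  then have "path_within {y. stl y \<in> - {w}} (act_pow gen_a m (False ## w)) (act_pow gen_a n (False ## w))"
    using mn by (intro lift_path_within_stl) (auto simp: act_pow_a_False)
  then have "path_within (- {False ## w}) (act_pow gen_a m (False ## w)) (act_pow gen_a n (False ## w))"
    by (rule path_within_mono) auto
  then show False using a mn unfolding splits_def by blast
qed

section \<open>Reversing cycles\<close>

lemma cycle_rank_unique: "cycle_rank k x \<Longrightarrow> cycle_rank l x \<Longrightarrow> k = l"
proof (induction k arbitrary: l x)
  case 0
  then show ?case by (cases l) auto
next
  case (Suc k)
  then show ?case by (cases l) auto
qed

text \<open>
Cycles are grouped by the position of the letter \<open>1\<close> that cuts their odometer off, and \<open>f m\<close>
tells whether the cycles cut off at position \<open>m\<close> are to be reversed. Infinite cycles are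
always reversed, so that the constant function \<open>True\<close> reverses every cycle.
\<close>

definition flip :: "(nat \<Rightarrow> bool) \<Rightarrow> binword \<Rightarrow> bool" where
  "flip f x \<longleftrightarrow> (\<forall>k. cycle_rank k x \<longrightarrow> f (2 * k))"

lemma flip_cycle_rank: "cycle_rank k x \<Longrightarrow> flip f x = f (2 * k)"
  unfolding flip_def using cycle_rank_unique by blast

lemma flip_SCons2: "flip f (False ## j ## w) = flip (f \<circ> Suc \<circ> Suc) w"
proof
  assume *: "flip f (False ## j ## w)"
  have "f (2 * Suc k)" if "cycle_rank k w" for k
    using *[unfolded flip_def, rule_format, of "Suc k"] that by simp
  then show "flip (f \<circ> Suc \<circ> Suc) w" by (simp add: flip_def)
next
  assume *: "flip (f \<circ> Suc \<circ> Suc) w"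
  have "f (2 * k)" if "cycle_rank k (False ## j ## w)" for k
    using that * by (cases k) (auto simp: flip_def)
  then show "flip f (False ## j ## w)" by (simp add: flip_def)
qed

lemma flip_act_a [simp]: "flip f (act gen_a x) = flip f x" "flip f (iact gen_a x) = flip f x"
  by (simp_all add: flip_def)

text \<open>
Reversing the \<open>b\<close>-cycle through \<open>0 w\<close> and \<open>1 w\<close> while fixing the words beginning with \<open>0\<close>
must exchange the two neighbours \<open>1 w\<close> and \<open>1 a(w)\<close> of \<open>0 w\<close>; this is the correction by
\<open>a\<^sup>-\<^sup>1\<close> behind a letter \<open>1\<close>. The shift of \<open>f\<close> keeps its index equal to the absolute
position.
\<close>

primcorec twist :: "(nat \<Rightarrow> bool) \<Rightarrow> binword \<Rightarrow> binword" where
  "twist f x = shd x ## twist (f \<circ> Suc)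
     (if shd x \<and> flip (f \<circ> Suc) (stl x) then iact gen_a (stl x) else stl x)"

lemma twist_SCons [simp]:
  "twist f (False ## w) = False ## twist (f \<circ> Suc) w"
  "twist f (True ## w) = True ## twist (f \<circ> Suc) (if flip (f \<circ> Suc) w then iact gen_a w else w)"
  by (subst twist.code; simp)+

lemma cycle_rank_twist [simp]: "cycle_rank k (twist f x) = cycle_rank k x"
proof (induction k arbitrary: f x)
  case 0
  then show ?case by simp
next
  case (Suc k)
  obtain i j w where "x = i ## j ## w" by (rule two_letters)
  then show ?case using Suc by (cases i; cases j) auto
qed

lemma a_line_twist [simp]: "a_line (twist f x) = a_line x"
  by (simp add: a_line_def)

lemma flip_twist [simp]: "flip g (twist f x) = flip g x"
  by (simp add: flip_def)

text \<open>
The direction that \<open>twist f\<close> gives to the \<open>s\<close>-cycle through \<open>x\<close>; the \<open>b\<close>-cycle of \<open>i w\<close>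
follows the \<open>a\<close>-cycle of \<open>w\<close>.
\<close>

definition reverses :: "(nat \<Rightarrow> bool) \<Rightarrow> gen \<Rightarrow> binword \<Rightarrow> bool" where
  "reverses f s x = (if s = gen_a then flip f x else flip (f \<circ> Suc) (stl x))"

lemma reverses_act [simp]: "reverses f s (act s x) = reverses f s x"
proof (cases s)
  case gen_a
  then show ?thesis by (simp add: reverses_def)
next
  case gen_b
  then show ?thesis by (cases x; cases "shd x") (auto simp: reverses_def)
qed

lemma reverses_iact [simp]: "reverses f s (iact s x) = reverses f s x"
  using reverses_act[of f s "iact s x"] by simp

lemma reverses_b_flip: "reverses (f \<circ> Suc) gen_b w = flip f (False ## w)"
  by (cases w) (simp add: reverses_def flip_SCons2)

lemma twist_act:
  "twist f (act s x) = (if reverses f s x then iact s (twist f x) else act s (twist f x))"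
proof (rule stream_eqI)
  fix m
  show "twist f (act s x) !! m =
      (if reverses f s x then iact s (twist f x) else act s (twist f x)) !! m"
  proof (induction m arbitrary: f s x)
    case 0
    then show ?case by (cases s; cases x; cases "shd x") auto
  next
    case (Suc m)
    obtain i w where x: "x = i ## w" by (cases x)
    show ?case
    proof (cases s)
      case gen_a
      show ?thesis
      proof (cases i)
        case True
        then show ?thesis unfolding x gen_a by simp
      next
        case False
        define f' where "f' = f \<circ> Suc"
        have rev: "reverses f gen_a x = flip f (False ## w)" "reverses f' gen_b w = flip f (False ## w)"
          using False by (simp_all add: reverses_def x f'_def flip: reverses_b_flip)
        show ?thesis unfolding gen_a rev
          using Suc.IH[of f' gen_b w] False unfolding rev by (simp add: x flip: f'_def)
      qed
    next
      case gen_b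
      have rev: "reverses f gen_b x = flip (f \<circ> Suc) w" by (simp add: reverses_def x)
      show ?thesis
      proof (cases i)
        case False
        define f' where "f' = f \<circ> Suc"
        show ?thesis unfolding gen_b rev
          using False Suc.IH[of f' gen_a w] by (simp add: x reverses_def flip: f'_def)
      next
        case True
        define f' where "f' = f \<circ> Suc"
        show ?thesis unfolding gen_b rev
          using True Suc.IH[of f' gen_a "iact gen_a w"] by (simp add: x reverses_def flip: f'_def)
      qed
    qed
  qed
qed

lemma twist_iact:
  "twist f (iact s x) = (if reverses f s x then act s (twist f x) else iact s (twist f x))"
  using twist_act[of f s "iact s x"] by (simp split: if_splits)

text \<open>
The correction made behind a letter \<open>1\<close> can be undone, because \<open>flip\<close> can be read from the
image as well as from the argument.
\<close>

lemma twist_eq_iff [simp]: "twist f x = twist f y \<longleftrightarrow> x = y"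
proof
  assume "twist f x = twist f y"
  show "x = y"
  proof (rule stream_eqI)
    fix m show "x !! m = y !! m" using \<open>twist f x = twist f y\<close>
    proof (induction m arbitrary: f x y)
      case 0
      then show ?case by (metis snth.simps(1) twist.simps(1))
    next
      case (Suc m)
      obtain i w j v where x: "x = i ## w" and y: "y = j ## v" by (metis stream.exhaust)
      have "shd (twist f x) = shd (twist f y)" using Suc.prems by simp
      then have ij: "i = j" unfolding x y by simp
      have "twist (f \<circ> Suc) w = twist (f \<circ> Suc) v"
      proof (cases j)
        case True
        let ?t = "\<lambda>w. if flip (f \<circ> Suc) w then iact gen_a w else w"
        have eq: "twist (f \<circ> Suc) (?t w) = twist (f \<circ> Suc) (?t v)"
          using Suc.prems unfolding x y ij by (simp add: True)
        have "flip (f \<circ> Suc) (?t w) = flip (f \<circ> Suc) (?t v)"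
          using eq flip_twist by metis
        then have "flip (f \<circ> Suc) w = flip (f \<circ> Suc) v"
          by (simp split: if_splits)
        then show ?thesis
          using eq by (auto simp: twist_iact reverses_def split: if_splits)
      next
        case False
        then show ?thesis using Suc.prems unfolding x y ij by simp
      qed
      then have "w !! m = v !! m" by (rule Suc.IH)
      then show ?case unfolding x y by simp
    qed
  qed
qed simp

lemma twist_orb: "y \<in> orb x \<Longrightarrow> twist f y \<in> orb (twist f x)"
  by (induction rule: orb_induct) (auto simp: twist_act twist_iact)

lemma twist_orbE:
  assumes "z \<in> orb (twist f x)" obtains y where "y \<in> orb x" "z = twist f y"
proof -
  have "\<exists>y\<in>orb x. z = twist f y"
    using assms
  proof (induction rule: orb_induct)
    case refl
    then show ?case using orb_refl by blast
  next
    case (act s z)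
    then obtain y where y: "y \<in> orb x" "z = twist f y" by blast
    then have "act s z = twist f (if reverses f s y then iact s y else act s y)"
      by (cases "reverses f s y") (simp_all add: twist_act twist_iact)
    moreover have "(if reverses f s y then iact s y else act s y) \<in> orb x" using y by simp
    ultimately show ?case by (rule bexI)
  next
    case (iact s z)
    then obtain y where y: "y \<in> orb x" "z = twist f y" by blast
    then have "iact s z = twist f (if reverses f s y then act s y else iact s y)"
      by (cases "reverses f s y") (simp_all add: twist_act twist_iact)
    moreover have "(if reverses f s y then act s y else iact s y) \<in> orb x" using y by simp
    ultimately show ?case by (rule bexI)
  qed
  then show thesis using that by blast
qed

text \<open>
The edge from \<open>u\<close> to \<open>act s u\<close> goes to the edge starting at the image of \<open>u\<close> if the cycle
keeps its direction, and at the image of \<open>act s u\<close> if it is reversed.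
\<close>

lemma isomorphic_twist: "isomorphic (schreier x) (schreier (twist f x))"
proof -
  define h where "h = (\<lambda>(u, s). (twist f (if reverses f s u then act s u else u), s))"
  have "bij_betw (twist f) (orb x) (orb (twist f x))"
    unfolding bij_betw_def by (auto simp: inj_on_def twist_orb elim: twist_orbE)
  moreover have "bij_betw h (orb x \<times> UNIV) (orb (twist f x) \<times> UNIV)"
    unfolding bij_betw_def
  proof
    show "inj_on h (orb x \<times> UNIV)"
      unfolding h_def by (rule inj_onI) (auto split: if_splits)
    show "h ` (orb x \<times> UNIV) = orb (twist f x) \<times> UNIV"
    proof (intro equalityI subsetI)
      fix e assume "e \<in> orb (twist f x) \<times> (UNIV :: gen set)"
      then obtain u s where e: "e = (twist f u, s)" "u \<in> orb x"
        by (cases e) (auto elim: twist_orbE)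
      have "e = h (if reverses f s u then iact s u else u, s)"
        unfolding h_def e by simp
      moreover have "(if reverses f s u then iact s u else u, s) \<in> orb x \<times> UNIV"
        using e by simp
      ultimately show "e \<in> h ` (orb x \<times> UNIV)" by blast
    qed (auto simp: h_def twist_orb)
  qed
  moreover have "endpoints (schreier (twist f x)) (h e) = twist f ` endpoints (schreier x) e" for e
    by (cases e) (auto simp: schreier_def h_def twist_act)
  ultimately show ?thesis
    unfolding isomorphic_def
    by (intro exI[of _ "twist f"] exI[of _ h]) (simp add: schreier_def)
qed

section \<open>Reversing all cycles\<close>

text \<open>
The involution that inverts both generators; it plays the part of complex conjugation if the
Basilica group is seen as the iterated monodromy group of \<open>z\<^sup>2 - 1\<close>.
\<close>

abbreviation tau :: "binword \<Rightarrow> binword" where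
  "tau \<equiv> twist (\<lambda>_. True)"

lemma reverses_True [simp]: "reverses (\<lambda>_. True) s x"
  by (simp add: reverses_def flip_def comp_def)

lemma const_Suc [simp]: "(\<lambda>_. c) \<circ> Suc = (\<lambda>_. c)"
  by auto

lemma flip_True [simp]: "flip (\<lambda>_. True) x"
  by (simp add: flip_def)

lemma tau_act [simp]: "tau (act s x) = iact s (tau x)" "tau (iact s x) = act s (tau x)"
  by (simp_all add: twist_act twist_iact)

lemma tau_tau [simp]: "tau (tau x) = x"
proof (rule stream_eqI)
  fix n show "tau (tau x) !! n = x !! n"
  proof (induction n arbitrary: x)
    case (Suc n)
    then show ?case by (cases x; cases "shd x") auto
  qed simp
qed

lemma tau_act_pow: "tau (act_pow s n x) = act_pow s (- n) (tau x)"
proof (induction n rule: int_step_induct)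
  case (succ n)
  have "tau (act_pow s (n + 1) x) = iact s (tau (act_pow s n x))" by (simp flip: act_act_pow)
  then show ?case using succ by (simp add: iact_act_pow)
next
  case (pred n)
  have "tau (act_pow s (n - 1) x) = act s (tau (act_pow s n x))" by (simp flip: iact_act_pow)
  then show ?case using pred by (simp add: act_act_pow)
qed simp

text \<open>
Parity: \<open>tau\<close> keeps the second letter of a word on an \<open>a\<close>-line, an odd power of \<open>a\<close> changes
it.
\<close>

lemma tau_eq_act_pow_even:
  assumes "a_line x" "tau x = act_pow gen_a n x"
  shows "even n"
proof -
  obtain j w where x: "x = False ## j ## w" using assms(1) by (rule a_lineE)
  have "shd (act_pow gen_b n (j ## w)) = j"
    using assms(2) by (cases j) (auto simp: x act_pow_a_False dest!: arg_cong[of _ _ shd])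
  then show ?thesis by (cases j) (auto simp: shd_act_pow_b)
qed

text \<open>
On an \<open>a\<close>-line, \<open>tau\<close> is negation of the 2-adic integer formed by the odd positions, and
only zero is its own negative.
\<close>

lemma tau_fixed_a_line:
  assumes "a_line x" "tau x = x"
  shows "x = sconst False"
proof -
  define R where "R y \<longleftrightarrow> a_line y \<and> tau y = y" for y
  have R: "\<exists>w. y = False ## False ## w \<and> R w" if y: "R y" for y
  proof -
    obtain j w where x: "y = False ## j ## w" "a_line w"
      using y unfolding R_def by (auto elim: a_lineE)
    show ?thesis
    proof (cases j)
      case True
      then have "act gen_a (tau w) = w" using y x by (simp add: R_def)
      then have "tau w = act_pow gen_a (- 1) w" by (simp add: act_eq_iff_iact)
      then show ?thesis using tau_eq_act_pow_even[OF x(2)] by fastforce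
    next
      case False
      then show ?thesis using x y by (simp add: R_def)
    qed
  qed
  have "R x" using assms by (simp add: R_def)
  then have "R x \<or> (\<exists>v. x = False ## v \<and> R v)" ..
  then show ?thesis
  proof (rule eq_zerosI[of "\<lambda>y. R y \<or> (\<exists>v. y = False ## v \<and> R v)"])
    fix y assume "R y \<or> (\<exists>v. y = False ## v \<and> R v)"
    then show "\<not> shd y \<and> (R (stl y) \<or> (\<exists>v. stl y = False ## v \<and> R v))"
      using R by fastforce
  qed
qed

text \<open>
If \<open>tau x\<close> is in the orbit, it is on the same \<open>a\<close>-line, say \<open>tau x = a\<^sup>n x\<close>. By parity
\<open>n = 2m\<close>, so the midpoint \<open>a\<^sup>m x\<close> is fixed by \<open>tau\<close> and must be \<open>0\<^sup>\<omega>\<close>.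
\<close>

lemma tau_notin_orb:
  assumes "a_line x" "sconst False \<notin> orb x"
  shows "tau x \<notin> orb x"
proof
  assume "tau x \<in> orb x"
  then have "path_within UNIV x (tau x)" by (simp add: orb_path_within)
  then have "\<exists>n\<in>UNIV. attach gen_a (tau x) = act_pow gen_a n x"
    by (rule attach_path_within[OF assms(1), of _ _ _ 0]) (use assms in \<open>auto simp: attach_a_line\<close>)
  then obtain n where n: "tau x = act_pow gen_a n x"
    using assms(1) by (auto simp: attach_a_line)
  then obtain m where m: "n = 2 * m"
    using tau_eq_act_pow_even[OF assms(1)] by blast
  have "tau (act_pow gen_a m x) = act_pow gen_a m x"
    by (simp add: tau_act_pow n m act_pow_add)
  then have "act_pow gen_a m x = sconst False"
    using assms(1) by (intro tau_fixed_a_line) auto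
  moreover have "act_pow gen_a m x \<in> orb x" by simp
  ultimately show False using assms(2) by simp
qed

section \<open>Isomorphisms up to the direction of cycles\<close>

text \<open>
Isomorphisms that respect labels but not directions. Comparing the sets of both
\<open>s\<close>-neighbours keeps track of multiplicities: by injectivity the set is a singleton at \<open>x\<close>
exactly if it is one at \<open>f x\<close>.
\<close>

definition label_iso :: "(binword \<Rightarrow> binword) \<Rightarrow> binword set \<Rightarrow> bool" where
  "label_iso f U \<longleftrightarrow> inj_on f U \<and>
    (\<forall>x\<in>U. \<forall>s. act s x \<in> U \<and> iact s x \<in> U \<and>
       {f (act s x), f (iact s x)} = {act s (f x), iact s (f x)})"

lemma label_isoD:
  assumes "label_iso f U" "x \<in> U"
  shows "act s x \<in> U" "iact s x \<in> U" "{f (act s x), f (iact s x)} = {act s (f x), iact s (f x)}"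
  using assms unfolding label_iso_def by blast+

lemma edge_neighbour: "{u, act s u} = {p, q} \<Longrightarrow> q = act s p \<or> q = iact s p"
  by (auto simp: doubleton_eq_iff)

text \<open>
Labels can be recovered from the unlabelled graph. A vertex carries a loop exactly if its
word begins with \<open>1\<close>, so first letters are kept; and \<open>b\<close>-edges are those whose ends have
different first letters.
\<close>

lemma label_iso_of_isomorphic:
  assumes "isomorphic (schreier x) (schreier y)"
  obtains f where "label_iso f (orb x)" "f ` orb x = orb y"
proof -
  obtain f h where f: "bij_betw f (orb x) (orb y)"
    and h: "bij_betw h (orb x \<times> (UNIV :: gen set)) (orb y \<times> (UNIV :: gen set))"
    and e: "\<forall>e\<in>orb x \<times> UNIV. endpoints (schreier y) (h e) = f ` endpoints (schreier x) e"
    using assms unfolding isomorphic_def by (auto simp: schreier_def)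
  have fh: "{u', act s' u'} = {f u, f (act s u)}" if "u \<in> orb x" "h (u, s) = (u', s')" for u s u' s'
    using bspec[OF e, of "(u, s)"] that by (simp add: schreier_def)
  have surj: "\<exists>u s. u \<in> orb x \<and> h (u, s) = (v, t)" if "v \<in> orb y" for v t
  proof -
    have "(v, t) \<in> h ` (orb x \<times> UNIV)"
      using bij_betw_imp_surj_on[OF h] that by simp
    then show ?thesis by (auto simp: eq_commute)
  qed
  have inj: "f u = f v \<longleftrightarrow> u = v" if "u \<in> orb x" "v \<in> orb x" for u v
    using bij_betw_imp_inj_on[OF f] that by (auto dest: inj_onD)
  have fy: "f u \<in> orb y" if "u \<in> orb x" for u
    using bij_betwE[OF f] that by blast
  have loop: "shd (f u) = shd u" if u: "u \<in> orb x" for u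
  proof
    assume "shd u"
    then have [simp]: "act gen_a u = u" by (simp add: act_a_fixed_iff)
    obtain u' s' where e: "h (u, gen_a) = (u', s')" by (cases "h (u, gen_a)")
    have "act s' (f u) = f u" using fh[OF u e] by auto
    then show "shd (f u)"
      by (cases s') (auto simp: act_a_fixed_iff, metis shd_act_b(1))
  next
    assume "shd (f u)"
    then have *: "act gen_a (f u) = f u" by (simp add: act_a_fixed_iff)
    obtain v s where v: "v \<in> orb x" "h (v, s) = (f u, gen_a)" using surj fy u by blast
    have "{f u} = {f v, f (act s v)}" using fh[OF v] * by simp
    then have "f v = f u" "f (act s v) = f u" by auto
    then have "v = u" "act s v = u" using inj v u by auto
    then show "shd u"
      by (cases s) (auto simp: act_a_fixed_iff, metis shd_act_b(1))
  qed
  have label: "s' = s" if "u \<in> orb x" "h (u, s) = (u', s')" for u s u' s'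
  proof -
    have "{u', act s' u'} = {f u, f (act s u)}" using fh that by blast
    then have "shd u' = shd (act s' u') \<longleftrightarrow> shd (f u) = shd (f (act s u))"
      unfolding doubleton_eq_iff by metis
    moreover have sh: "shd (act s x) = shd x \<longleftrightarrow> s = gen_a" for s x
      by (cases s) auto
    moreover have "shd (f (act s u)) = shd (act s u)" using loop[of "act s u"] that(1) orb_act(1) by blast
    ultimately have "s' = gen_a \<longleftrightarrow> s = gen_a"
      using sh[of s' u'] sh[of s u] loop[OF that(1)] by argo
    then show ?thesis by (cases s; cases s') auto
  qed
  have nb: "f (act s u) = act s (f u) \<or> f (act s u) = iact s (f u)" if "u \<in> orb x" for u s
  proof -
    obtain u' s' where e: "h (u, s) = (u', s')" by (cases "h (u, s)")
    show ?thesis using fh[OF that e] label[OF that e] edge_neighbour by metis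
  qed
  have nb': "act s (f u) = f (act s u) \<or> act s (f u) = f (iact s u)"
    "iact s (f u) = f (act s u) \<or> iact s (f u) = f (iact s u)" if u: "u \<in> orb x" for u s
  proof -
    have *: "q = f (act s u) \<or> q = f (iact s u)"
      if q: "{z, act s z} = {f u, q}" "z \<in> orb y" for q z
    proof -
      obtain v t where v: "v \<in> orb x" "h (v, t) = (z, s)" using surj[OF q(2)] by blast
      then have "t = s" using label by blast
      then have "{f u, q} = {f v, f (act s v)}" using fh[OF v] q by simp
      then have "f v = f u \<and> q = f (act s v) \<or> f (act s v) = f u \<and> q = f v"
        by (auto simp: doubleton_eq_iff)
      then have "v = u \<and> q = f (act s v) \<or> act s v = u \<and> q = f v"
        using inj u v by auto
      then show ?thesis by auto
    qed
    show "act s (f u) = f (act s u) \<or> act s (f u) = f (iact s u)"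
      using *[of "f u" "act s (f u)"] fy u by blast
    show "iact s (f u) = f (act s u) \<or> iact s (f u) = f (iact s u)"
      using *[of "iact s (f u)" "iact s (f u)"] fy u by (simp add: insert_commute)
  qed
  have "label_iso f (orb x)"
    unfolding label_iso_def
  proof (intro conjI ballI allI)
    fix u s assume u: "u \<in> orb x"
    then show "act s u \<in> orb x" "iact s u \<in> orb x" by auto
    have "f (iact s u) = act s (f u) \<or> f (iact s u) = iact s (f u)"
      using nb[of "iact s u" s] u by auto
    then show "{f (act s u), f (iact s u)} = {act s (f u), iact s (f u)}"
      using nb[OF u, of s] nb'[OF u, of s] by auto
  qed (rule bij_betw_imp_inj_on[OF f])
  then show thesis using that bij_betw_imp_surj_on[OF f] by blast
qed

lemma label_iso_shd:
  assumes "label_iso f U" "x \<in> U"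
  shows "shd (f x) = shd x"
proof
  assume "shd x"
  then have "act gen_a x = x" "iact gen_a x = x" by (metis act_a_fixed_iff iact_act)+
  then have "act gen_a (f x) = f x"
    using label_isoD(3)[OF assms, of gen_a] by auto
  then show "shd (f x)" by (simp add: act_a_fixed_iff)
next
  assume "shd (f x)"
  then have "act gen_a (f x) = f x" "iact gen_a (f x) = f x" by (metis act_a_fixed_iff iact_act)+
  then have "f (act gen_a x) = f x"
    using label_isoD(3)[OF assms, of gen_a] by auto
  then have "act gen_a x = x"
    using assms label_isoD(1)[OF assms, of gen_a] unfolding label_iso_def by (meson inj_onD)
  then show "shd x" by (simp add: act_a_fixed_iff)
qed

text \<open>
This is desubstitution. Write \<open>f (0 w) = 0 g(w)\<close> and \<open>f (1 w) = 1 u(w)\<close>. The \<open>a\<close>-edges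
between words beginning with \<open>0\<close> are the \<open>b\<close>-edges of the tails. The vertex \<open>1 w\<close> is the
midpoint of the path \<open>0 a\<^sup>-\<^sup>1(w), 1 w, 0 w\<close>, which stands for an \<open>a\<close>-edge of the tails, and
it is mapped to the midpoint of the image path; hence \<open>g\<close> preserves \<open>a\<close>-edges as well, and
\<open>u(w)\<close> is one of \<open>g(w)\<close> and \<open>g(a\<^sup>-\<^sup>1(w))\<close>.
\<close>

lemma label_iso_stl:
  fixes f U
  assumes f: "label_iso f U"
  defines "g \<equiv> \<lambda>w. stl (f (False ## w))"
  shows "label_iso g {w. False ## w \<in> U}"
    and "\<And>w. False ## w \<in> U \<Longrightarrow> f (False ## w) = False ## g w"
    and "\<And>w. True ## w \<in> U \<Longrightarrow> f (True ## w) = True ## g w \<or> f (True ## w) = True ## g (iact gen_a w)"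
proof -
  define u where "u w = stl (f (True ## w))" for w
  have f0: "f (False ## w) = False ## g w" if "False ## w \<in> U" for w
    using label_iso_shd[OF f that] by (cases "f (False ## w)") (auto simp: g_def)
  have f1: "f (True ## w) = True ## u w" if "True ## w \<in> U" for w
    using label_iso_shd[OF f that] by (cases "f (True ## w)") (auto simp: u_def)
  have U0: "False ## act s w \<in> U \<and> False ## iact s w \<in> U" if "False ## w \<in> U" for s w
  proof (cases s)
    case gen_a
    then show ?thesis
      using label_isoD(1)[OF f label_isoD(1)[OF f that, of gen_b], of gen_b]
        label_isoD(2)[OF f label_isoD(2)[OF f that, of gen_b], of gen_b] by simp
  next
    case gen_b
    then show ?thesis
      using label_isoD(1)[OF f that, of gen_a] label_isoD(2)[OF f that, of gen_a] by simp
  qed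
  have U1: "True ## w \<in> U \<longleftrightarrow> False ## w \<in> U" for w
    using label_isoD(1)[OF f, of "True ## w" gen_b] label_isoD(2)[OF f, of "False ## w" gen_b] by auto
  have up: "{g v, g (iact gen_a v)} = {u v, iact gen_a (u v)}" if "False ## v \<in> U" for v
  proof -
    have T: "True ## v \<in> U" using that U1 by simp
    have "{f (False ## v), f (False ## iact gen_a v)} =
        {act gen_b (True ## u v), iact gen_b (True ## u v)}"
      using label_isoD(3)[OF f T, of gen_b] f1[OF T] by simp
    then have "(##) False ` {g v, g (iact gen_a v)} = (##) False ` {u v, iact gen_a (u v)}"
      using f0 U0 that by simp
    then show ?thesis by (auto simp: doubleton_eq_iff)
  qed
  have down: "{u (act gen_a v), u v} = {act gen_a (g v), g v}" if "False ## v \<in> U" for v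
  proof -
    have "{f (True ## act gen_a v), f (True ## v)} =
        {act gen_b (False ## g v), iact gen_b (False ## g v)}"
      using label_isoD(3)[OF f that, of gen_b] f0[OF that] by simp
    then have "(##) True ` {u (act gen_a v), u v} = (##) True ` {act gen_a (g v), g v}"
      using f1 U0 U1 that by simp
    then show ?thesis by (auto simp: doubleton_eq_iff)
  qed
  have ginj: "inj_on g {w. False ## w \<in> U}"
  proof (rule inj_onI)
    fix v w assume *: "v \<in> {w. False ## w \<in> U}" "w \<in> {w. False ## w \<in> U}" "g v = g w"
    then have "f (False ## v) = f (False ## w)" using f0 by simp
    then show "v = w" using f * unfolding label_iso_def by (auto dest: inj_onD)
  qed
  show "label_iso g {w. False ## w \<in> U}"
    unfolding label_iso_def
  proof (intro conjI ballI allI ginj)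
    fix w s assume "w \<in> {w. False ## w \<in> U}"
    then have w: "False ## w \<in> U" by simp
    show "act s w \<in> {w. False ## w \<in> U}" "iact s w \<in> {w. False ## w \<in> U}"
      using U0 w by auto
    show "{g (act s w), g (iact s w)} = {act s (g w), iact s (g w)}"
    proof (cases s)
      case gen_b
      have "{f (False ## act gen_b w), f (False ## iact gen_b w)} =
          {act gen_a (False ## g w), iact gen_a (False ## g w)}"
        using label_isoD(3)[OF f w, of gen_a] f0[OF w] by simp
      then have "(##) False ` {g (act gen_b w), g (iact gen_b w)} =
          (##) False ` {act gen_b (g w), iact gen_b (g w)}"
        using f0 U0 w by simp
      then show ?thesis unfolding gen_b by (auto simp: doubleton_eq_iff)
    next
      case gen_a
      let ?w = "act gen_a w"
      have 1: "{g w, g (iact gen_a w)} = {u w, iact gen_a (u w)}" using up w by blast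
      have 2: "{g ?w, g w} = {u ?w, iact gen_a (u ?w)}" using up[of ?w] U0 w by simp
      have 3: "{u ?w, u w} = {act gen_a (g w), g w}" using down w by blast
      \<comment> \<open>The two midpoints next to \<open>0 w\<close> keep their places if the cycle keeps its direction, and
        exchange them if it is reversed.\<close>
      from 3 consider "u ?w = act gen_a (g w)" "u w = g w" | "u ?w = g w" "u w = act gen_a (g w)"
        by (auto simp: doubleton_eq_iff)
      then show ?thesis
      proof cases
        case same: 1
        have "g (iact gen_a w) = iact gen_a (g w)" using 1 same by (auto simp: doubleton_eq_iff)
        moreover have "g ?w = act gen_a (g w)" using 2 same by (auto simp: doubleton_eq_iff)
        ultimately show ?thesis unfolding gen_a by simp
      next
        case swap: 2
        have "g (iact gen_a w) = act gen_a (g w)" using 1 swap by (auto simp: doubleton_eq_iff)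
        moreover have "g ?w = iact gen_a (g w)" using 2 swap by (auto simp: doubleton_eq_iff)
        ultimately show ?thesis unfolding gen_a by auto
      qed
    qed
  qed
  show "\<And>w. False ## w \<in> U \<Longrightarrow> f (False ## w) = False ## g w" by (rule f0)
  show "\<And>w. True ## w \<in> U \<Longrightarrow> f (True ## w) = True ## g w \<or> f (True ## w) = True ## g (iact gen_a w)"
    using f1 up U1 by (metis doubleton_eq_iff)
qed

lemma label_iso_tau:
  assumes "label_iso f U" shows "label_iso (tau \<circ> f) U"
  unfolding label_iso_def
proof (intro conjI ballI allI)
  show "inj_on (tau \<circ> f) U"
    using assms unfolding label_iso_def inj_on_def by simp
  fix x s assume x: "x \<in> U"
  show "act s x \<in> U" "iact s x \<in> U" using label_isoD[OF assms x] by auto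
  have "tau ` {f (act s x), f (iact s x)} = tau ` {act s (f x), iact s (f x)}"
    using label_isoD(3)[OF assms x, of s] by simp
  then show "{(tau \<circ> f) (act s x), (tau \<circ> f) (iact s x)} =
      {act s ((tau \<circ> f) x), iact s ((tau \<circ> f) x)}"
    by (simp add: insert_commute)
qed

text \<open>
A direction once chosen is kept along the whole cycle.
\<close>

lemma label_iso_act_pow:
  assumes f: "label_iso f U" and x: "x \<in> U" and start: "f (act s x) = act s (f x)"
  shows "act_pow s n x \<in> U" "f (act_pow s n x) = act_pow s n (f x)"
proof -
  have U: "act_pow s n x \<in> U" for n
    by (induction n rule: int_step_induct) (use x label_isoD[OF f] in \<open>auto simp flip: act_act_pow iact_act_pow\<close>)
  have nb: "{f (act_pow s (n + 1) x), f (act_pow s (n - 1) x)} = {act s (f (act_pow s n x)), iact s (f (act_pow s n x))}" for n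
    using label_isoD(3)[OF f U, of s n] by (simp add: act_act_pow iact_act_pow)
  have "f (act_pow s n x) = act_pow s n (f x) \<and> f (act_pow s (n + 1) x) = act_pow s (n + 1) (f x)"
  proof (induction n rule: int_step_induct)
    case zero
    then show ?case using start by simp
  next
    case (succ n)
    then have "f (act_pow s (n + 1 + 1) x) = act_pow s (n + 1 + 1) (f x)"
      using nb[of "n + 1"] by (auto simp: act_act_pow iact_act_pow doubleton_eq_iff)
    then show ?case using succ by simp
  next
    case (pred n)
    then have "f (act_pow s (n - 1) x) = act_pow s (n - 1) (f x)"
      using nb[of n] by (auto simp: act_act_pow iact_act_pow doubleton_eq_iff)
    then show ?case using pred by simp
  qed
  then show "act_pow s n x \<in> U" "f (act_pow s n x) = act_pow s n (f x)" using U by auto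
qed

text \<open>
If the direction of the line is kept, first letters determine everything: the restriction to
the tails two letters further on again keeps the direction of an \<open>a\<close>-line, so all letters of
\<open>x\<close> and \<open>f x\<close> agree.
\<close>

lemma label_iso_a_line_fixed:
  assumes "label_iso f U" "x \<in> U" "a_line x" "f (act gen_a x) = act gen_a (f x)"
  shows "f x = x"
proof -
  let ?P = "\<lambda>(f, U, x). label_iso f U \<and> x \<in> U \<and> a_line x \<and> f (act gen_a x) = act gen_a (f x)"
  have "(\<lambda>(f, U, x). f x) (f, U, x) = (\<lambda>(f, U, x). x) (f, U, x)"
  proof (rule stream_coinduct2[where P = ?P])
    show "?P (f, U, x)" using assms by simp
    fix p assume "?P p"
    then obtain f U x where p: "p = (f, U, x)" and f: "label_iso f U" "x \<in> U" and x: "a_line x"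
      and com: "f (act gen_a x) = act gen_a (f x)" by (cases p) auto
    obtain j w where jw: "x = False ## j ## w" "a_line w" using x by (rule a_lineE)
    define g where "g w = stl (f (False ## w))" for w
    define V where "V = {w. False ## w \<in> U}"
    have g: "label_iso g V" "\<And>w. w \<in> V \<Longrightarrow> f (False ## w) = False ## g w"
      using label_iso_stl[OF f(1)] unfolding g_def V_def by auto
    define h where "h w = stl (g (False ## w))" for w
    define W where "W = {w. False ## w \<in> V}"
    have h: "label_iso h W" "\<And>w. w \<in> W \<Longrightarrow> g (False ## w) = False ## h w"
      using label_iso_stl[OF g(1)] unfolding h_def W_def by auto
    have gpw: "act_pow gen_b n (j ## w) \<in> V \<and> g (act_pow gen_b n (j ## w)) = act_pow gen_b n (g (j ## w))" for n
    proof -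
      have V: "act_pow gen_b n (j ## w) \<in> V" for n
        using label_iso_act_pow(1)[OF f com, of n] by (simp add: jw act_pow_a_False V_def)
      have "f (act_pow gen_a n x) = act_pow gen_a n (f x)" using label_iso_act_pow(2)[OF f com] .
      then have "False ## g (act_pow gen_b n (j ## w)) = act_pow gen_a n (False ## g (j ## w))"
        using g(2)[OF V[of n]] g(2)[OF V[of 0]] by (simp add: jw act_pow_a_False)
      then show ?thesis using V by (simp add: act_pow_a_False)
    qed
    \<comment> \<open>If the second letter is \<open>1\<close>, one \<open>b\<close>-step leads from \<open>j w\<close> to \<open>0 w\<close>, where the second
      desubstitution applies.\<close>
    define e :: int where "e = (if j then 1 else 0)"
    have e: "act_pow gen_b e (j ## w) = False ## w" by (auto simp: e_def)
    have hpw: "False ## act_pow gen_a n w \<in> V \<and> False ## h (act_pow gen_a n w) = act_pow gen_b (2 * n + e) (g (j ## w))" for n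
    proof -
      have eq: "act_pow gen_b (2 * n + e) (j ## w) = False ## act_pow gen_a n w"
        using e by (simp flip: act_pow_add add: act_pow_b_even)
      have "False ## act_pow gen_a n w \<in> V" "g (False ## act_pow gen_a n w) = act_pow gen_b (2 * n + e) (g (j ## w))"
        using gpw[of "2 * n + e"] unfolding eq by auto
      then show ?thesis using h(2)[of "act_pow gen_a n w"] by (simp add: W_def)
    qed
    have 0: "act_pow gen_b e (g (j ## w)) = False ## h w" using hpw[of 0] by simp
    then have "act_pow gen_b (- e) (act_pow gen_b e (g (j ## w))) = act_pow gen_b (- e) (False ## h w)" by simp
    then have "g (j ## w) = act_pow gen_b (- e) (False ## h w)" by (simp add: act_pow_add)
    then have gj: "g (j ## w) = j ## h w" by (auto simp: e_def)
    have "False ## h (act gen_a w) = act_pow gen_b 2 (act_pow gen_b e (g (j ## w)))"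
      using hpw[of 1] by (simp add: act_pow_add)
    also have "\<dots> = False ## act gen_a (h w)"
      unfolding 0 using act_pow_b_even[of 1] by simp
    finally have "h (act gen_a w) = act gen_a (h w)" by simp
    moreover have "w \<in> W" using hpw[of 0] by (simp add: W_def)
    ultimately have "?P (h, W, w)" using h(1) jw by simp
    moreover have "f x = False ## j ## h w"
      using g(2)[of "j ## w"] gpw[of 0] gj jw by simp
    ultimately show "(\<lambda>(f, U, x). f x) p = (\<lambda>(f, U, x). x) p \<or>
      (\<exists>i j q. (\<lambda>(f, U, x). f x) p = i ## j ## (\<lambda>(f, U, x). f x) q \<and>
        (\<lambda>(f, U, x). x) p = i ## j ## (\<lambda>(f, U, x). x) q \<and> ?P q)"
      unfolding p jw(1)
      by (intro disjI2 exI[of _ False] exI[of _ j] exI[of _ "(h, W, w)"]) (simp add: jw)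
  qed
  then show ?thesis by simp
qed

text \<open>
If \<open>f\<close> reverses the line, \<open>tau \<circ> f\<close> keeps its direction.
\<close>

lemma label_iso_a_line:
  assumes f: "label_iso f U" "x \<in> U" "a_line x"
  shows "f x = x \<or> f x = tau x"
proof -
  have "f (act gen_a x) = act gen_a (f x) \<or> f (act gen_a x) = iact gen_a (f x)"
    using label_isoD(3)[OF f(1,2), of gen_a] by (auto simp: doubleton_eq_iff)
  then show ?thesis
  proof
    assume "f (act gen_a x) = act gen_a (f x)"
    then show ?thesis using label_iso_a_line_fixed[OF f] by simp
  next
    assume "f (act gen_a x) = iact gen_a (f x)"
    then have "(tau \<circ> f) (act gen_a x) = act gen_a ((tau \<circ> f) x)" by simp
    then have "(tau \<circ> f) x = x" using label_iso_a_line_fixed[OF label_iso_tau[OF f(1)] f(2,3)] by blast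
    then have "tau (tau (f x)) = tau x" by simp
    then show ?thesis by simp
  qed
qed

lemma label_iso_a_line_b:
  assumes f: "label_iso f U" "False ## x \<in> U" "a_line x"
  shows "f (False ## x) = False ## x \<or> f (False ## x) = tau (False ## x)"
proof -
  have "stl (f (False ## x)) = x \<or> stl (f (False ## x)) = tau x"
    using label_iso_a_line[OF label_iso_stl(1)[OF f(1)], of x] f by simp
  then show ?thesis using label_iso_stl(2)[OF f(1,2)] by auto
qed

section \<open>Counting ends of a multigraph\<close>

definition linked :: "('v, 'e) multigraph \<Rightarrow> 'v set \<Rightarrow> 'v \<Rightarrow> 'v \<Rightarrow> bool" where
  "linked G S u v \<longleftrightarrow> u \<in> verts G - S \<and> v \<in> verts G - S \<and> rtranclp (adjacent (delete_verts G S)) u v"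

lemma linked_sym: "linked G S u v \<Longrightarrow> linked G S v u"
proof -
  have "symp (adjacent (delete_verts G S))"
    by (auto intro!: sympI simp: adjacent_def insert_commute)
  then show "linked G S u v \<Longrightarrow> linked G S v u"
    unfolding linked_def by (metis symp_rtranclp sympD)
qed

lemma linked_trans: "linked G S u v \<Longrightarrow> linked G S v w \<Longrightarrow> linked G S u w"
  unfolding linked_def by auto

lemma linked_refl: "u \<in> verts G - S \<Longrightarrow> linked G S u u"
  unfolding linked_def by simp

lemma linked_mono:
  assumes "linked G T u v" "S \<subseteq> T"
  shows "linked G S u v"
proof -
  have "adjacent (delete_verts G T) \<le> adjacent (delete_verts G S)"
  proof (intro predicate2I)
    fix u v assume "adjacent (delete_verts G T) u v"
    then obtain e where e: "e \<in> edges G" "endpoints G e \<inter> T = {}" "endpoints G e = {u, v}"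
      by (auto simp: adjacent_def delete_verts_def)
    then have "endpoints G e \<inter> S = {}" using assms(2) by blast
    then show "adjacent (delete_verts G S) u v"
      using e by (auto simp: adjacent_def delete_verts_def)
  qed
  then show ?thesis
    using assms rtranclp_mono unfolding linked_def by blast
qed

lemma equiv_linked: "equiv (verts G - S) {(u, v). linked G S u v}"
proof (rule equivI)
  show "refl_on (verts G - S) {(u, v). linked G S u v}"
    unfolding refl_on_def using linked_refl by fast
  show "{(u, v). linked G S u v} \<subseteq> (verts G - S) \<times> (verts G - S)"
    by (auto simp: linked_def)
  show "sym {(u, v). linked G S u v}"
    unfolding sym_def using linked_sym by fast
  show "trans {(u, v). linked G S u v}"
    unfolding trans_def using linked_trans by fast
qed

lemma graph_components_linked:
  "graph_components (delete_verts G S) = (verts G - S) // {(u, v). linked G S u v}"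
  unfolding graph_components_def by (auto simp: delete_verts_def linked_def)

lemma finite_ray_visits:
  assumes "r \<in> rays G" "finite S"
  obtains m where "\<And>n. n \<ge> m \<Longrightarrow> r n \<notin> S"
proof -
  have "finite (r -` S)"
    using assms by (auto simp: rays_def intro: finite_vimageI)
  then obtain m where "\<forall>n\<in>r -` S. n < m"
    by (metis finite_nat_set_iff_bounded)
  then have "\<And>n. n \<ge> m \<Longrightarrow> r n \<notin> S"
    using linorder_not_less by blast
  then show thesis using that by blast
qed

lemma ray_tail_linked:
  assumes r: "r \<in> rays G" and out: "\<And>n. n \<ge> m \<Longrightarrow> r n \<notin> S" and "n \<ge> m" "n' \<ge> m"
  shows "linked G S (r n) (r n')"
proof -
  have *: "linked G S (r m) (r n)" if "n \<ge> m" for n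
    using that
  proof (induction n rule: dec_induct)
    case base
    then show ?case using r out by (auto simp: rays_def intro!: linked_refl)
  next
    case (step n)
    have "adjacent G (r n) (r (Suc n))" using r by (auto simp: rays_def)
    then have "adjacent (delete_verts G S) (r n) (r (Suc n))"
      using out[of n] out[of "Suc n"] step by (auto simp: adjacent_def delete_verts_def)
    moreover have "r (Suc n) \<in> verts G - S"
      using r out[of "Suc n"] step by (auto simp: rays_def)
    ultimately show ?case using step unfolding linked_def by auto
  qed
  show ?thesis using *[OF assms(3)] *[OF assms(4)] linked_sym linked_trans by metis
qed

text \<open>
All late vertices of the two rays lie in one component after deletion of \<open>S\<close>; this is the
form of the end relation that composes well.
\<close>

definition tails_linked :: "('v, 'e) multigraph \<Rightarrow> 'v set \<Rightarrow> (nat \<Rightarrow> 'v) \<Rightarrow> (nat \<Rightarrow> 'v) \<Rightarrow> bool" where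
  "tails_linked G S r s \<longleftrightarrow> (\<exists>m. \<forall>n\<ge>m. \<forall>n'\<ge>m. linked G S (r n) (s n'))"

lemma tails_linked_refl:
  assumes "r \<in> rays G" "finite S" shows "tails_linked G S r r"
proof -
  obtain m where "\<And>n. n \<ge> m \<Longrightarrow> r n \<notin> S" using finite_ray_visits[OF assms] by blast
  then show ?thesis unfolding tails_linked_def using ray_tail_linked[OF assms(1)] by blast
qed

lemma tails_linked_sym: "tails_linked G S r s \<Longrightarrow> tails_linked G S s r"
  unfolding tails_linked_def using linked_sym by metis

lemma tails_linked_trans:
  assumes "tails_linked G S r s" "tails_linked G S s t"
  shows "tails_linked G S r t"
proof -
  obtain m m' where m: "\<And>n n'. n \<ge> m \<Longrightarrow> n' \<ge> m \<Longrightarrow> linked G S (r n) (s n')"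
    and m': "\<And>n n'. n \<ge> m' \<Longrightarrow> n' \<ge> m' \<Longrightarrow> linked G S (s n) (t n')"
    using assms unfolding tails_linked_def by metis
  have "linked G S (r n) (t n')" if "n \<ge> max m m'" "n' \<ge> max m m'" for n n'
    using m[of n "max m m'"] m'[of "max m m'" n'] that by (auto intro: linked_trans)
  then show ?thesis unfolding tails_linked_def by blast
qed

lemma tails_linked_mono: "tails_linked G T r s \<Longrightarrow> S \<subseteq> T \<Longrightarrow> tails_linked G S r s"
  unfolding tails_linked_def using linked_mono by metis

lemma end_rel_tails_linked:
  "end_rel G = {(r, s). r \<in> rays G \<and> s \<in> rays G \<and>
     (\<forall>S. finite S \<and> S \<subseteq> verts G \<longrightarrow> tails_linked G S r s)}"
proof -
  have "(\<exists>C\<in>graph_components (delete_verts G S).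
          (\<exists>m. \<forall>n\<ge>m. r n \<in> C) \<and> (\<exists>m. \<forall>n\<ge>m. s n \<in> C)) \<longleftrightarrow> tails_linked G S r s" for r s S
  proof
    assume "tails_linked G S r s"
    then obtain m where m: "\<And>n n'. n \<ge> m \<Longrightarrow> n' \<ge> m \<Longrightarrow> linked G S (r n) (s n')"
      unfolding tails_linked_def by blast
    let ?C = "{(u, v). linked G S u v} `` {r m}"
    have "r m \<in> verts G - S" using m[of m m] by (simp add: linked_def)
    then have "?C \<in> graph_components (delete_verts G S)"
      unfolding graph_components_linked by (rule quotientI)
    moreover have "\<forall>n\<ge>m. s n \<in> ?C" using m by simp
    moreover have "\<forall>n\<ge>m. r n \<in> ?C"
      using m[of m m] m[of _ m] by (auto intro: linked_trans linked_sym)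
    ultimately show "\<exists>C\<in>graph_components (delete_verts G S).
          (\<exists>m. \<forall>n\<ge>m. r n \<in> C) \<and> (\<exists>m. \<forall>n\<ge>m. s n \<in> C)" by blast
  next
    assume "\<exists>C\<in>graph_components (delete_verts G S).
          (\<exists>m. \<forall>n\<ge>m. r n \<in> C) \<and> (\<exists>m. \<forall>n\<ge>m. s n \<in> C)"
    then obtain C m m' where C: "C \<in> graph_components (delete_verts G S)"
      and m: "\<And>n. n \<ge> m \<Longrightarrow> r n \<in> C" "\<And>n. n \<ge> m' \<Longrightarrow> s n \<in> C" by blast
    have "linked G S u v" if "u \<in> C" "v \<in> C" for u v
      using quotient_eq_iff[OF equiv_linked C[unfolded graph_components_linked]
          C[unfolded graph_components_linked] that] by simp
    then have "linked G S (r n) (s n')" if "n \<ge> max m m'" "n' \<ge> max m m'" for n n'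
      using m that by auto
    then show "tails_linked G S r s" unfolding tails_linked_def by blast
  qed
  then show ?thesis unfolding end_rel_def by simp
qed

lemma equiv_end_rel: "equiv (rays G) (end_rel G)"
proof (rule equivI)
  show "refl_on (rays G) (end_rel G)"
    by (auto simp: refl_on_def end_rel_tails_linked intro: tails_linked_refl)
  show "end_rel G \<subseteq> rays G \<times> rays G"
    by (auto simp: end_rel_def)
  show "sym (end_rel G)"
    by (auto simp: sym_def end_rel_tails_linked intro: tails_linked_sym)
  show "trans (end_rel G)"
    unfolding trans_def end_rel_tails_linked by (auto intro: tails_linked_trans)
qed

text \<open>
Counting ends by representatives. The rays in \<open>R\<close> are pairwise separated by \<open>Z\<close>, and
arbitrarily large finite sets leave at most \<open>card R\<close> pieces. By the pigeonhole principle
each such piece contains a tail of exactly one ray of \<open>R\<close>, so every ray is equivalent to a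
ray of \<open>R\<close>. Which one does not depend on the finite set removed, because it is already
determined by removing \<open>Z\<close>.
\<close>

lemma ended_card_rays:
  assumes R: "finite R" "R \<noteq> {}" "R \<subseteq> rays G" and Z: "finite Z" "Z \<subseteq> verts G"
    and sep: "\<And>r s. r \<in> R \<Longrightarrow> s \<in> R \<Longrightarrow> r \<noteq> s \<Longrightarrow> \<not> tails_linked G Z r s"
    and cover: "\<And>S. finite S \<Longrightarrow> S \<subseteq> verts G \<Longrightarrow> \<exists>T N. finite T \<and> S \<subseteq> T \<and> T \<subseteq> verts G \<and>
        finite N \<and> card N \<le> card R \<and> (\<forall>v\<in>verts G - T. \<exists>u\<in>N. linked G T v u)"
  shows "ended (card R) G"
proof -
  have step: "\<exists>r\<in>R. tails_linked G S s r" if s: "s \<in> rays G" and S: "finite S" "S \<subseteq> verts G" "Z \<subseteq> S" for s S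
  proof -
    obtain T N where T: "finite T" "S \<subseteq> T" "T \<subseteq> verts G" and N: "finite N" "card N \<le> card R"
      and TN: "\<And>v. v \<in> verts G - T \<Longrightarrow> \<exists>u\<in>N. linked G T v u"
      using cover[OF S(1,2)] by blast
    have tail: "\<exists>u\<in>N. \<exists>m. \<forall>n\<ge>m. linked G T (r n) u" if r: "r \<in> rays G" for r
    proof -
      obtain m where m: "\<And>n. n \<ge> m \<Longrightarrow> r n \<notin> T" using finite_ray_visits[OF r T(1)] by blast
      have "r m \<in> verts G - T" using m[of m] r by (auto simp: rays_def)
      then obtain u where u: "u \<in> N" "linked G T (r m) u" using TN by blast
      have "linked G T (r n) u" if "n \<ge> m" for n
        using ray_tail_linked[OF r m that, of m] u(2) linked_trans by fastforce
      then show ?thesis using u by blast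
    qed
    have link: "tails_linked G T r r'"
      if "\<forall>n\<ge>m. linked G T (r n) u" "\<forall>n\<ge>m'. linked G T (r' n) u" for r r' u m m'
    proof -
      have "linked G T (r n) (r' n')" if "n \<ge> max m m'" "n' \<ge> max m m'" for n n'
        using that \<open>\<forall>n\<ge>m. linked G T (r n) u\<close> \<open>\<forall>n\<ge>m'. linked G T (r' n) u\<close>
        by (intro linked_trans[of G T "r n" u "r' n'"] linked_sym[of G T "r' n'" u]) auto
      then show ?thesis unfolding tails_linked_def by blast
    qed
    \<comment> \<open>The piece that contains a tail of \<open>r\<close>, given by its representative in \<open>N\<close>.\<close>
    define c where "c r = (SOME u. u \<in> N \<and> (\<exists>m. \<forall>n\<ge>m. linked G T (r n) u))" for r :: "nat \<Rightarrow> 'a"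
    have c: "c r \<in> N \<and> (\<exists>m. \<forall>n\<ge>m. linked G T (r n) (c r))" if "r \<in> rays G" for r
      unfolding c_def by (rule someI_ex) (use tail[OF that] in blast)
    have "inj_on c R"
    proof (rule inj_onI)
      fix r r' assume r: "r \<in> R" "r' \<in> R" "c r = c r'"
      then have "tails_linked G T r r'" using link c R(3) by (metis subsetD)
      then have "tails_linked G Z r r'" using tails_linked_mono T(2) S(3) by blast
      then show "r = r'" using sep r by blast
    qed
    moreover have "c ` R \<subseteq> N" using c R(3) by blast
    ultimately have "c ` R = N"
      using N by (metis card_image card_seteq)
    then obtain r where r: "r \<in> R" "c s = c r" using c[OF s] by blast
    then have "tails_linked G T s r" using link c R(3) s by (metis subsetD)
    then show ?thesis using tails_linked_mono T(2) r by blast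
  qed
  have rep: "\<exists>r\<in>R. (s, r) \<in> end_rel G" if s: "s \<in> rays G" for s
  proof -
    obtain r where r: "r \<in> R" "tails_linked G Z s r"
      using step[OF s Z] by blast
    have "tails_linked G S s r" if S: "finite S" "S \<subseteq> verts G" for S
    proof -
      obtain r' where r': "r' \<in> R" "tails_linked G (S \<union> Z) s r'"
        using step[OF s, of "S \<union> Z"] S Z by auto
      have "tails_linked G Z s r'" using tails_linked_mono[OF r'(2)] by simp
      then have "tails_linked G Z r r'"
        using r(2) tails_linked_sym tails_linked_trans by blast
      then have "r' = r" using sep r r' by blast
      then show ?thesis using tails_linked_mono[OF r'(2)] by simp
    qed
    then show ?thesis using r s R(3) unfolding end_rel_tails_linked by blast
  qed
  have "graph_ends G = (\<lambda>r. end_rel G `` {r}) ` R"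
    unfolding graph_ends_def
  proof (intro equalityI subsetI)
    fix C assume "C \<in> rays G // end_rel G"
    then obtain s where s: "s \<in> rays G" "C = end_rel G `` {s}" by (auto elim: quotientE)
    then obtain r where "r \<in> R" "(s, r) \<in> end_rel G" using rep by blast
    then show "C \<in> (\<lambda>r. end_rel G `` {r}) ` R"
      using equiv_class_eq[OF equiv_end_rel] s by blast
  qed (use R(3) in \<open>auto intro: quotientI\<close>)
  moreover have "inj_on (\<lambda>r. end_rel G `` {r}) R"
  proof (rule inj_onI)
    fix r s assume rs: "r \<in> R" "s \<in> R" "end_rel G `` {r} = end_rel G `` {s}"
    then have "(r, s) \<in> end_rel G"
      using eq_equiv_class[OF rs(3) equiv_end_rel] R(3) by blast
    then have "tails_linked G Z r s" using Z by (auto simp: end_rel_tails_linked)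
    then show "r = s" using sep rs by blast
  qed
  ultimately show ?thesis unfolding ended_def by (simp add: card_image)
qed

lemma ended_card_index:
  assumes I: "finite I" "I \<noteq> {}" and \<rho>: "\<And>i. i \<in> I \<Longrightarrow> \<rho> i \<in> rays G"
    and Z: "finite Z" "Z \<subseteq> verts G"
    and sep: "\<And>i j. i \<in> I \<Longrightarrow> j \<in> I \<Longrightarrow> i \<noteq> j \<Longrightarrow> \<not> tails_linked G Z (\<rho> i) (\<rho> j)"
    and cover: "\<And>S. finite S \<Longrightarrow> S \<subseteq> verts G \<Longrightarrow> \<exists>T N. finite T \<and> S \<subseteq> T \<and> T \<subseteq> verts G \<and>
        finite N \<and> card N \<le> card I \<and> (\<forall>v\<in>verts G - T. \<exists>u\<in>N. linked G T v u)"
  shows "ended (card I) G"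
proof -
  have "inj_on \<rho> I"
    using tails_linked_refl[OF \<rho> Z(1)] sep by (metis inj_onI)
  then have card: "card (\<rho> ` I) = card I" by (rule card_image)
  have "ended (card (\<rho> ` I)) G"
  proof (rule ended_card_rays[OF _ _ _ Z])
    show "\<rho> ` I \<subseteq> rays G" using \<rho> by blast
    show "\<not> tails_linked G Z r s" if "r \<in> \<rho> ` I" "s \<in> \<rho> ` I" "r \<noteq> s" for r s
      using sep that by blast
  qed (use I cover card in auto)
  then show ?thesis using card by simp
qed

section \<open>Paths and rays in Schreier graphs\<close>

lemma verts_schreier [simp]: "verts (schreier \<xi>) = orb \<xi>"
  by (simp add: schreier_def)

lemma adjacent_schreier: "adjacent (schreier \<xi>) u v \<longleftrightarrow> u \<in> orb \<xi> \<and> step u v"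
proof
  assume "adjacent (schreier \<xi>) u v"
  then obtain x s where x: "x \<in> orb \<xi>" "{x, act s x} = {u, v}"
    by (auto simp: adjacent_def schreier_def)
  then have "x = u \<and> v = act s u \<or> x = v \<and> u = act s v"
    by (auto simp: doubleton_eq_iff)
  then show "u \<in> orb \<xi> \<and> step u v" using x(1) by (auto simp: step_act)
next
  assume uv: "u \<in> orb \<xi> \<and> step u v"
  then obtain s where "v = act s u \<or> u = act s v" unfolding step_def by blast
  then show "adjacent (schreier \<xi>) u v"
  proof
    assume "v = act s u"
    then show ?thesis
      using uv unfolding adjacent_def schreier_def by (intro bexI[of _ "(u, s)"]) simp_all
  next
    assume "u = act s v"
    then show ?thesis
      using uv unfolding adjacent_def schreier_def by (intro bexI[of _ "(v, s)"]) auto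
  qed
qed

lemma adjacent_delete: "adjacent (delete_verts G S) u v \<longleftrightarrow> adjacent G u v \<and> u \<notin> S \<and> v \<notin> S"
  by (auto simp: adjacent_def delete_verts_def)

lemma linked_schreier:
  "linked (schreier \<xi>) S u v \<longleftrightarrow> u \<in> orb \<xi> - S \<and> path_within (orb \<xi> - S) u v"
proof -
  have "adjacent (delete_verts (schreier \<xi>) S) u v \<longleftrightarrow> step u v \<and> u \<in> orb \<xi> - S \<and> v \<in> orb \<xi> - S" for u v
    unfolding adjacent_delete adjacent_schreier using orb_step[of u v \<xi>] by blast
  then have "adjacent (delete_verts (schreier \<xi>) S) =
      (\<lambda>u v. step u v \<and> u \<in> orb \<xi> - S \<and> v \<in> orb \<xi> - S)"
    by (intro ext)
  then have A: "(adjacent (delete_verts (schreier \<xi>) S))\<^sup>*\<^sup>* u v = path_within (orb \<xi> - S) u v"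
    unfolding path_within_def by (rule arg_cong)
  have B: "v \<in> orb \<xi> - S" if "u \<in> orb \<xi> - S" "path_within (orb \<xi> - S) u v"
    using path_within_mem[OF that(2,1)] .
  show ?thesis
    unfolding linked_def verts_schreier A
  proof (intro iffI conjI; (elim conjE)?)
    assume "u \<in> orb \<xi> - S" "path_within (orb \<xi> - S) u v"
    then show "v \<in> orb \<xi> - S" by (rule B)
  qed
qed

lemma tails_linked_schreier:
  assumes "tails_linked (schreier \<xi>) S r s"
  obtains n where "path_within (- S) (r n) (s n)"
proof -
  obtain n where "linked (schreier \<xi>) S (r n) (s n)"
    using assms unfolding tails_linked_def by blast
  then have "path_within (- S) (r n) (s n)"
    unfolding linked_schreier using path_within_mono[of "orb \<xi> - S" "r n" "s n" "- S"] by auto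
  then show thesis by (rule that)
qed

lemma rays_schreier:
  "r \<in> rays (schreier \<xi>) \<longleftrightarrow> range r \<subseteq> orb \<xi> \<and> inj r \<and> (\<forall>n. step (r n) (r (Suc n)))"
  unfolding rays_def verts_schreier mem_Collect_eq adjacent_schreier by blast

definition line_ray :: "gen \<Rightarrow> binword \<Rightarrow> int \<Rightarrow> nat \<Rightarrow> binword" where
  "line_ray s x e n = act_pow s (e * (int n + 1)) x"

lemma line_ray:
  assumes "splits s x" "e \<in> {1, - 1}"
  shows "line_ray s x e \<in> rays (schreier x)"
  unfolding rays_schreier
proof (intro conjI allI)
  show "range (line_ray s x e) \<subseteq> orb x" by (auto simp: line_ray_def)
  show "inj (line_ray s x e)"
  proof (rule injI)
    fix m n assume "line_ray s x e m = line_ray s x e n"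
    then have "e * (int m + 1) - e * (int n + 1) = 0"
      using assms(1) unfolding splits_def line_ray_def act_pow_eq_iff by blast
    then show "m = n" using assms(2) by auto
  qed
  fix n
  have "line_ray s x e (Suc n) = act s (line_ray s x e n) \<or> line_ray s x e (Suc n) = iact s (line_ray s x e n)"
    using assms(2) by (auto simp: line_ray_def act_act_pow iact_act_pow algebra_simps)
  then show "step (line_ray s x e n) (line_ray s x e (Suc n))"
    by (auto simp: step_act)
qed

text \<open>
The two rays start next to \<open>x\<close> on either side of it and never return to it.
\<close>

lemma splits_sep:
  assumes "splits s x" "e \<in> {1, - 1}" "e' \<in> {1, - 1}" "e \<noteq> e'"
  shows "\<not> tails_linked (schreier x) {x} (line_ray s x e) (line_ray s x e')"
proof
  assume "tails_linked (schreier x) {x} (line_ray s x e) (line_ray s x e')"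
  then obtain n where n: "path_within (- {x}) (line_ray s x e n) (line_ray s x e' n)"
    by (rule tails_linked_schreier)
  have "\<not> path_within (- {x}) (act_pow s (int n + 1) x) (act_pow s (- int n - 1) x)"
    using assms(1) unfolding splits_def by simp
  then show False
    using n path_within_sym[OF n] assms(2-4) by (auto simp: line_ray_def)
qed

lemma sdrop_fibre: "{y. sdrop n y = t} = (\<lambda>l. l @- t) ` {l. length l = n}"
proof (intro equalityI subsetI)
  fix y assume "y \<in> {y. sdrop n y = t}"
  then have "y = stake n y @- t" by (metis mem_Collect_eq stake_sdrop)
  then show "y \<in> (\<lambda>l. l @- t) ` {l. length l = n}" by (metis (mono_tags) image_eqI length_stake mem_Collect_eq)
qed (auto simp: sdrop_shift)

lemma finite_sdrop_fibre: "finite {y :: binword. sdrop n y = t}"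
  and card_sdrop_fibre: "card {y :: binword. sdrop n y = t} = 2 ^ n"
proof -
  have fin: "finite {l :: bool list. length l = n}"
    using finite_lists_length_eq[of "UNIV :: bool set" n] by simp
  have card: "card {l :: bool list. length l = n} = 2 ^ n"
    using card_lists_length_eq[of "UNIV :: bool set" n] by simp
  have "inj_on (\<lambda>l. l @- t) {l :: bool list. length l = n}"
  proof (rule inj_onI)
    fix l l' :: "bool list"
    assume "l \<in> {l. length l = n}" "l' \<in> {l. length l = n}" "l @- t = l' @- t"
    then have "stake n (l @- t) = stake n (l' @- t)" "length l = n" "length l' = n" by auto
    then show "l = l'" by (simp add: stake_shift)
  qed
  then show "finite {y :: binword. sdrop n y = t}" "card {y :: binword. sdrop n y = t} = 2 ^ n"
    unfolding sdrop_fibre using fin card by (auto simp: card_image)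
qed

lemma infinite_orb: "infinite (orb \<xi>)"
proof
  assume fin: "finite (orb \<xi>)"
  have "2 ^ n \<le> card (orb \<xi>)" for n
    using card_mono[OF fin, of "{y. sdrop n y = sdrop n \<xi>}"] cofinal_orb
    by (force simp: card_sdrop_fibre)
  then have "2 ^ card (orb \<xi>) \<le> card (orb \<xi>)" .
  then show False using less_exp[of "card (orb \<xi>)"] by simp
qed

text \<open>
Koenig's lemma. The state is a vertex together with the finite set of vertices visited
before, such that infinitely many vertices can be reached from it without meeting that set;
one of the at most four neighbours inherits this property.
\<close>

lemma ray_exists: "\<exists>r. r \<in> rays (schreier \<xi>)"
proof -
  define good where "good = (\<lambda>(F, v). v \<in> orb \<xi> - F \<and> infinite {w. path_within (orb \<xi> - F) v w})"
  have ex: "\<exists>v'. step v v' \<and> good (insert v F, v')" if g: "good (F, v)" for F v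
  proof -
    \<comment> \<open>A path that leaves \<open>v\<close> for the last time continues from one of these neighbours.\<close>
    define N where "N = {v'. step v v'} \<inter> (orb \<xi> - insert v F)"
    have "{v'. step v v'} \<subseteq> (\<lambda>s. act s v) ` {gen_a, gen_b} \<union> (\<lambda>s. iact s v) ` {gen_a, gen_b}"
      by (auto elim!: stepE) (metis gen.exhaust)+
    then have finN: "finite N" unfolding N_def by (auto intro: finite_subset)
    have "w = v \<or> (\<exists>v'\<in>N. path_within (orb \<xi> - insert v F) v' w)" if "path_within (orb \<xi> - F) v w" for w
      using that
    proof (induction rule: path_within_induct)
      case (step y w)
      show ?case
      proof (cases "w = v")
        case False
        then have w: "w \<in> orb \<xi> - insert v F" using step by blast
        show ?thesis
        proof (cases "y = v")
          case True
          then have "w \<in> N" using step w by (simp add: N_def)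
          then show ?thesis by (intro disjI2 bexI[of _ w]) auto
        next
          case False
          then obtain v' where v': "v' \<in> N" "path_within (orb \<xi> - insert v F) v' y" using step(5) by auto
          have "path_within (orb \<xi> - insert v F) y w"
            using step(2-4) False w by (intro path_within_step) auto
          then show ?thesis using v'(1) path_within_trans[OF v'(2)] by auto
        qed
      qed simp
    qed simp
    then have "{w. path_within (orb \<xi> - F) v w} \<subseteq> {v} \<union> (\<Union>v'\<in>N. {w. path_within (orb \<xi> - insert v F) v' w})"
      by blast
    moreover have "infinite {w. path_within (orb \<xi> - F) v w}" using g by (simp add: good_def)
    ultimately have "infinite ({v} \<union> (\<Union>v'\<in>N. {w. path_within (orb \<xi> - insert v F) v' w}))"
      by (rule infinite_super)
    then obtain v' where "v' \<in> N" "infinite {w. path_within (orb \<xi> - insert v F) v' w}"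
      using finN by auto
    then show ?thesis unfolding good_def N_def by auto
  qed
  have "good ({}, \<xi>)"
  proof -
    have "{w. path_within (orb \<xi> - {}) \<xi> w} = orb \<xi>"
    proof -
      have *: "path_within (orb \<xi>) \<xi> w" if "path_within UNIV \<xi> w" for w
        using that
      proof (induction rule: path_within_induct)
        case (step v w)
        then have v: "v \<in> orb \<xi>" by (simp add: orb_path_within)
        then have "w \<in> orb \<xi>" using orb_step[OF step(2)] by blast
        then have "path_within (orb \<xi>) v w" using v step(2) by (intro path_within_step)
        then show ?case by (rule path_within_trans[OF step(5)])
      qed simp
      have "w \<in> orb \<xi>" if "path_within (orb \<xi>) \<xi> w" for w
        using that by (rule path_within_mem) simp
      moreover have "path_within (orb \<xi>) \<xi> w" if "w \<in> orb \<xi>" for w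
        using that by (intro *) (simp add: orb_path_within)
      ultimately show ?thesis unfolding Diff_empty by blast
    qed
    then show ?thesis using infinite_orb by (simp add: good_def)
  qed
  have "\<exists>f. \<forall>n. good (f n) \<and>
      (step (snd (f n)) (snd (f (Suc n))) \<and> fst (f (Suc n)) = insert (snd (f n)) (fst (f n)))"
  proof (rule dependent_nat_choice)
    show "\<exists>p. good p" using \<open>good ({}, \<xi>)\<close> by blast
    fix p :: "binword set \<times> binword"
    assume "good p"
    then obtain v' where "step (snd p) v'" "good (insert (snd p) (fst p), v')"
      using ex[of "fst p" "snd p"] by auto
    then show "\<exists>q. good q \<and> step (snd p) (snd q) \<and> fst q = insert (snd p) (fst p)"
      by (intro exI[of _ "(insert (snd p) (fst p), v')"]) simp
  qed
  then obtain f where f: "\<And>n. good (f n)"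
    and fS: "\<And>n. step (snd (f n)) (snd (f (Suc n))) \<and> fst (f (Suc n)) = insert (snd (f n)) (fst (f n))"
    by blast
  define r where "r n = snd (f n)" for n
  have vis: "r m \<in> fst (f n)" if "m < n" for m n
    using that
  proof (induction n)
    case (Suc n)
    then show ?case using fS[of n] by (cases "m = n") (auto simp: r_def)
  qed simp
  have out: "r n \<in> orb \<xi>" "r n \<notin> fst (f n)" for n
    using f[of n] by (auto simp: good_def r_def split: prod.splits)
  have "inj r"
  proof (rule linorder_injI)
    fix m n :: nat assume "m < n"
    then show "r m \<noteq> r n" using vis[of m n] out(2)[of n] by auto
  qed
  then have "r \<in> rays (schreier \<xi>)"
    unfolding rays_schreier using out(1) fS by (auto simp: r_def)
  then show ?thesis by (rule exI[of _ r])
qed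

section \<open>Ends of Schreier graphs\<close>

text \<open>
Follow a path from \<open>v\<close> to \<open>t\<close> up to the last vertex before it first enters \<open>F\<close>.
\<close>

lemma outer_boundary:
  assumes "v \<in> orb t - F" "t \<in> F"
  shows "\<exists>u\<in>orb t - F. (\<exists>x\<in>F. step x u) \<and> path_within (orb t - F) v u"
proof -
  have "path_within UNIV t v" using assms(1) by (simp add: orb_path_within)
  then have "v \<notin> F \<longrightarrow> (\<exists>u\<in>orb t - F. (\<exists>x\<in>F. step x u) \<and> path_within (orb t - F) v u)"
  proof (induction rule: path_within_induct)
    case refl
    then show ?case using assms(2) by simp
  next
    case (step y w)
    then have "y \<in> orb t" by (simp add: orb_path_within)
    then have orb: "y \<in> orb t" "w \<in> orb t" using orb_step[OF step(2)] by blast+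
    show ?case
    proof
      assume w: "w \<notin> F"
      show "\<exists>u\<in>orb t - F. (\<exists>x\<in>F. step x u) \<and> path_within (orb t - F) w u"
      proof (cases "y \<in> F")
        case True
        then show ?thesis using w orb step(2) by (intro bexI[of _ w]) auto
      next
        case False
        obtain u where u: "u \<in> orb t - F" "\<exists>x\<in>F. step x u" "path_within (orb t - F) y u"
          using mp[OF step(5) False] by (elim bexE conjE) (rule that, assumption, rule bexI)
        have "path_within (orb t - F) w y"
          using step_sym[OF step(2)] by (rule path_within_step) (use orb w False in simp_all)
        then have "path_within (orb t - F) w u" using u(3) by (rule path_within_trans)
        then show ?thesis using u(1,2) by blast
      qed
    qed
  qed
  then show ?thesis using assms(1) by simp
qed

text \<open>
Deleting from the orbit of \<open>\<xi>\<close> all words with a tail in \<open>F\<close> leaves at most as many pieces as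
deleting \<open>F\<close> from the orbit of the tail of \<open>\<xi>\<close>, and there it suffices to look at the
neighbours of \<open>F\<close>.
\<close>

lemma cover_tiles:
  fixes \<xi> n defines "t \<equiv> sdrop n \<xi>"
  assumes F: "finite F" "t \<in> F" and S: "S \<subseteq> orb \<xi>" "sdrop n ` S \<subseteq> F" and M: "finite M" "card M \<le> k"
    and bd: "\<And>x u. x \<in> F \<Longrightarrow> step x u \<Longrightarrow> u \<in> orb t - F \<Longrightarrow> \<exists>u'\<in>M. path_within (orb t - F) u u'"
  shows "\<exists>T N. finite T \<and> S \<subseteq> T \<and> T \<subseteq> verts (schreier \<xi>) \<and> finite N \<and> card N \<le> k \<and>
    (\<forall>v\<in>verts (schreier \<xi>) - T. \<exists>u\<in>N. linked (schreier \<xi>) T v u)"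
proof (intro exI conjI ballI)
  let ?T = "{y \<in> orb \<xi>. sdrop n y \<in> F}" and ?N = "(\<lambda>u. replicate n False @- u) ` M"
  have "?T \<subseteq> (\<Union>t\<in>F. {y. sdrop n y = t})" by blast
  then show "finite ?T" using F(1) finite_sdrop_fibre by (meson finite_UN_I finite_subset)
  show "S \<subseteq> ?T" "?T \<subseteq> verts (schreier \<xi>)" using S by auto
  show "finite ?N" using M by simp
  show "card ?N \<le> k" using card_image_le[OF M(1)] M(2) le_trans by blast
  fix v assume "v \<in> verts (schreier \<xi>) - ?T"
  then have v: "v \<in> orb \<xi>" "sdrop n v \<notin> F" by auto
  then have v': "sdrop n v \<in> orb t - F" by (simp add: t_def orb_sdrop_iff)
  then obtain u x where u: "u \<in> orb t - F" "x \<in> F" "step x u" "path_within (orb t - F) (sdrop n v) u"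
    using outer_boundary[OF v' F(2)] by blast
  obtain u' where u': "u' \<in> M" "path_within (orb t - F) u u'"
    using bd[OF u(2,3,1)] by blast
  then have u': "u' \<in> M" "path_within (orb t - F) (sdrop n v) u'"
    using path_within_trans[OF u(4)] by blast+
  have "path_within {y. sdrop n y \<in> orb t - F} v (replicate n False @- u')"
    using u'(2) v' by (rule lift_path_within) (auto simp: sdrop_shift)
  moreover have "{y. sdrop n y \<in> orb t - F} = orb \<xi> - ?T"
    by (auto simp: t_def orb_sdrop_iff)
  ultimately have "path_within (orb \<xi> - ?T) v (replicate n False @- u')" by simp
  then have "linked (schreier \<xi>) ?T v (replicate n False @- u')"
    unfolding linked_schreier using v by simp
  then show "\<exists>u\<in>?N. linked (schreier \<xi>) ?T v u" using u'(1) by blast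
qed

lemma eventually_sdrop_eq:
  assumes "y \<in> orb \<xi>" "sconst False \<notin> orb \<xi>"
  shows "\<forall>\<^sub>F n in sequentially. sdrop n y = sdrop n \<xi>"
proof -
  obtain m where m: "sdrop m y = sdrop m \<xi>" using orb_cofinal[OF assms] by blast
  have "sdrop n y = sdrop n \<xi>" if "n \<ge> m" for n
  proof -
    have "sdrop (n - m) (sdrop m y) = sdrop (n - m) (sdrop m \<xi>)" using m by simp
    then show ?thesis using that by simp
  qed
  then show ?thesis unfolding eventually_sequentially by blast
qed

lemma sdrop_sconst [simp]: "sdrop n (sconst c) = sconst c"
  by (induction n) auto

text \<open>
Otherwise \<open>\<xi>\<close> would end in \<open>0\<^sup>\<omega>\<close>.
\<close>

lemma frequently_True:
  assumes "sconst False \<notin> orb \<xi>"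
  shows "\<exists>n\<ge>m. shd (sdrop n \<xi>)"
proof (rule ccontr)
  assume "\<not> (\<exists>n\<ge>m. shd (sdrop n \<xi>))"
  then have "sdrop m \<xi> !! n = sconst False !! n" for n
    using le_add1[of m n] by (simp add: sdrop_snth)
  then have "sdrop m \<xi> = sconst False" by (rule stream_eqI)
  then have "sdrop m \<xi> = sdrop m (sconst False)" by simp
  then have "\<xi> \<in> orb (sconst False)" by (rule cofinal_orb)
  then show False using assms orb_sym by blast
qed

text \<open>
As \<open>0\<^sup>\<omega>\<close> is not in the orbit, the tiles of \<open>\<xi>\<close> exhaust it, and infinitely many of their
tails begin with \<open>1\<close>.
\<close>

lemma tile_at_True:
  assumes "finite S" "S \<subseteq> orb \<xi>" "sconst False \<notin> orb \<xi>"
  obtains n where "shd (sdrop n \<xi>)" "sdrop n ` S \<subseteq> {sdrop n \<xi>}"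
proof -
  have "\<forall>\<^sub>F n in sequentially. \<forall>y\<in>S. sdrop n y = sdrop n \<xi>"
    using assms by (intro eventually_ball_finite) (auto intro: eventually_sdrop_eq)
  then obtain m where m: "\<And>n. n \<ge> m \<Longrightarrow> \<forall>y\<in>S. sdrop n y = sdrop n \<xi>"
    unfolding eventually_sequentially by blast
  obtain n where "n \<ge> m" "shd (sdrop n \<xi>)" using frequently_True[OF assms(3)] by blast
  then show thesis using m that by blast
qed

lemma step_from_True:
  assumes "shd t" "step t u" "u \<noteq> t"
  shows "u = act gen_b t \<or> u = iact gen_b t"
proof -
  have a: "act gen_a t = t" using assms(1) by (simp add: act_a_fixed_iff)
  then have "iact gen_a t = t" by (metis iact_act)
  then show ?thesis using assms(2,3) a by (elim stepE) (metis gen.exhaust)+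
qed

text \<open>
A tile whose tail begins with \<open>1\<close> leaves at most two pieces, one for each \<open>b\<close>-neighbour of
the tail, whichever generator the infinite cycle belongs to.
\<close>

lemma splits_two_ended:
  assumes "splits s \<xi>" "sconst False \<notin> orb \<xi>"
  shows "ended 2 (schreier \<xi>)"
proof -
  have "ended (card {1, - 1 :: int}) (schreier \<xi>)"
  proof (rule ended_card_index[where \<rho> = "line_ray s \<xi>" and Z = "{\<xi>}"])
    fix S assume S: "finite S" "S \<subseteq> verts (schreier \<xi>)"
    then obtain n where n: "shd (sdrop n \<xi>)" "sdrop n ` S \<subseteq> {sdrop n \<xi>}"
      using tile_at_True[OF S(1) _ assms(2)] by auto
    let ?t = "sdrop n \<xi>"
    show "\<exists>T N. finite T \<and> S \<subseteq> T \<and> T \<subseteq> verts (schreier \<xi>) \<and> finite N \<and>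
        card N \<le> card {1, - 1 :: int} \<and> (\<forall>v\<in>verts (schreier \<xi>) - T. \<exists>u\<in>N. linked (schreier \<xi>) T v u)"
    proof (rule cover_tiles[where F = "{?t}" and M = "{act gen_b ?t, iact gen_b ?t}" and n = n])
      show "card {act gen_b ?t, iact gen_b ?t} \<le> card {1, - 1 :: int}"
        by (simp add: card_insert_if)
      fix x u assume "x \<in> {?t}" "step x u" "u \<in> orb ?t - {?t}"
      then have "u \<in> {act gen_b ?t, iact gen_b ?t}"
        using step_from_True[OF n(1), of u] by auto
      then show "\<exists>u'\<in>{act gen_b ?t, iact gen_b ?t}. path_within (orb ?t - {?t}) u u'"
        by (rule bexI[rotated]) simp
    qed (use S n in auto)
  qed (use assms line_ray splits_sep in auto)
  then show ?thesis by (simp add: numeral_2_eq_2)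
qed

text \<open>
Walk around the finite \<open>b\<close>-cycle the other way.
\<close>

lemma b_neighbours_linked:
  assumes "finite_cycles t"
  shows "path_within (orb t - {t}) (act gen_b t) (iact gen_b t)"
proof -
  obtain k where "cycle_rank k (stl t)" using assms finite_cycles_cycle_rank finite_cycles_stl by blast
  then have "act_pow gen_b (2 * 2 ^ k) t = t"
    using act_pow_b_even[of "2 ^ k" "shd t" "stl t"] cycle_rank_period by simp
  then have "\<exists>l::nat. l > 0 \<and> act_pow gen_b (int l) t = t"
    by (intro exI[of _ "2 * 2 ^ k"]) simp
  then obtain l :: nat where l: "l > 0" "act_pow gen_b (int l) t = t"
    and min: "\<And>j::nat. j < l \<Longrightarrow> \<not> (j > 0 \<and> act_pow gen_b (int j) t = t)"
    using exists_least_iff[of "\<lambda>l::nat. l > 0 \<and> act_pow gen_b (int l) t = t"] by blast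
  have path_within: "path_within (orb t - {t}) (act gen_b t) (act_pow gen_b (int j) t)" if "1 \<le> j" "j < l" for j
    using that
  proof (induction j rule: dec_induct)
    case (step j)
    have "path_within (orb t - {t}) (act_pow gen_b (int j) t) (act gen_b (act_pow gen_b (int j) t))"
      using min[of j] min[of "Suc j"] step
      by (intro path_within_step step_act) (auto simp: act_act_pow algebra_simps)
    moreover have "act gen_b (act_pow gen_b (int j) t) = act_pow gen_b (int (Suc j)) t"
      by (simp add: act_act_pow algebra_simps)
    ultimately show ?case using step path_within_trans[of "orb t - {t}" "act gen_b t" "act_pow gen_b (int j) t"] by simp
  qed simp
  have "act gen_b t \<noteq> t" by (metis shd_act_b(1))
  then have "l \<noteq> 1" using l by auto
  then have "path_within (orb t - {t}) (act gen_b t) (act_pow gen_b (int (l - 1)) t)"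
    using l(1) by (intro path_within) auto
  moreover have "act_pow gen_b (int (l - 1)) t = iact gen_b t"
    using iact_act_pow[of gen_b "int l" t] l by (simp add: of_nat_diff)
  ultimately show ?thesis by simp
qed

lemma not_finite_cycles_zeros: "\<not> finite_cycles (sconst False)"
  using a_line_zeros finite_cycles_cycle_rank unfolding a_line_def by blast

lemma finite_cycles_one_ended:
  assumes "finite_cycles \<xi>"
  shows "ended 1 (schreier \<xi>)"
proof -
  have z: "sconst False \<notin> orb \<xi>"
    using finite_cycles_orb not_finite_cycles_zeros assms by blast
  obtain r where r: "r \<in> rays (schreier \<xi>)" using ray_exists by blast
  have "ended (card {()}) (schreier \<xi>)"
  proof (rule ended_card_index[where \<rho> = "\<lambda>_. r" and Z = "{}"])
    fix S assume S: "finite S" "S \<subseteq> verts (schreier \<xi>)"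
    then obtain n where n: "shd (sdrop n \<xi>)" "sdrop n ` S \<subseteq> {sdrop n \<xi>}"
      using tile_at_True[OF S(1) _ z] by auto
    let ?t = "sdrop n \<xi>"
    show "\<exists>T N. finite T \<and> S \<subseteq> T \<and> T \<subseteq> verts (schreier \<xi>) \<and> finite N \<and>
        card N \<le> card {()} \<and> (\<forall>v\<in>verts (schreier \<xi>) - T. \<exists>u\<in>N. linked (schreier \<xi>) T v u)"
    proof (rule cover_tiles[where F = "{?t}" and M = "{iact gen_b ?t}" and n = n])
      fix x u assume "x \<in> {?t}" "step x u" "u \<in> orb ?t - {?t}"
      then have "u = act gen_b ?t \<or> u = iact gen_b ?t"
        using step_from_True[OF n(1), of u] by auto
      then show "\<exists>u'\<in>{iact gen_b ?t}. path_within (orb ?t - {?t}) u u'"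
        using b_neighbours_linked[of ?t] assms by auto
    qed (use S n in auto)
  qed (use r in auto)
  then show ?thesis by simp
qed

lemma attach_act_pow_b: "attach gen_a (act_pow gen_b n x) = attach gen_a x"
proof (induction n rule: int_step_induct)
  case (succ n)
  then show ?case using attach_act_b[of "act_pow gen_b n x"] by (simp add: act_act_pow)
next
  case (pred n)
  then show ?case using attach_act_b[of "act_pow gen_b (n - 1) x"] by (simp add: act_act_pow)
qed simp

text \<open>
The tiles of \<open>0\<^sup>\<omega>\<close> do not exhaust its orbit: the words ending in \<open>(01)\<^sup>\<omega> = a(0\<^sup>\<omega>)\<close> or
\<open>(10)\<^sup>\<omega> = b(0\<^sup>\<omega>)\<close> also belong to it. Therefore the tiles of several tails are removed
together. The four rays run along the two lines through \<open>0\<^sup>\<omega>\<close>.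
\<close>

lemma zeros_four_ended: "ended 4 (schreier (sconst False))"
proof -
  define zeros where "zeros = sconst False"
  let ?a = "act gen_a zeros" and ?b = "act gen_b zeros"
  let ?ba = "act gen_b ?a"
  have zeros: "zeros = False ## zeros" unfolding zeros_def by (rule sconst_SCons)
  have a: "?a = False ## ?b" and b: "?b = True ## ?a"
    by (subst zeros; simp)+
  have ba: "?ba = True ## True ## ?a"
    by (subst a; subst b; simp)
  have o2: "zeros = False ## False ## zeros" using zeros by metis
  have a2: "sdrop (2 * k) ?a = ?a" and b2: "sdrop (2 * k) ?b = ?b" and o2k: "sdrop (2 * k) zeros = zeros" for k
  proof -
    have "stl (stl ?a) = ?a" "stl (stl ?b) = ?b" "stl (stl zeros) = zeros"
      using a b zeros by (metis stream.sel(2))+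
    then show "sdrop (2 * k) ?a = ?a" "sdrop (2 * k) ?b = ?b" "sdrop (2 * k) zeros = zeros"
      by (induction k) simp_all
  qed
  have orb_form: "\<exists>k. sdrop (2 * k) y \<in> {zeros, ?a, ?b}" if "y \<in> orb zeros" for y
  proof -
    have cof: "\<exists>k. sdrop (2 * k) z \<in> {zeros, ?a, ?b}"
      if y: "sdrop (2 * k) y \<in> {zeros, ?a, ?b}" and n: "sdrop n z = sdrop n y" for y z k n
    proof -
      have "sdrop (2 * (k + n)) z = sdrop (2 * k + n) (sdrop n z)" by (simp add: algebra_simps)
      also have "\<dots> = sdrop (2 * n) (sdrop (2 * k) y)" unfolding n by (simp add: algebra_simps)
      also have "\<dots> \<in> {zeros, ?a, ?b}" using y a2 b2 o2k by (metis insert_iff singletonD)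
      finally show ?thesis by blast
    qed
    show ?thesis using that
    proof (induction rule: orb_induct)
      case refl
      show ?case by (intro exI[of _ 0]) simp
    next
      case (act s y)
      show ?case
      proof (cases "y = zeros")
        case True
        then show ?thesis by (intro exI[of _ 0]) (cases s; simp)
      next
        case False
        then show ?thesis using act act_cofinal[of y s] cof unfolding zeros_def by metis
      qed
    next
      case (iact s y)
      show ?case
      proof (cases "iact s y = zeros")
        case True
        then show ?thesis by (intro exI[of _ 0]) simp
      next
        case False
        then obtain n where "sdrop n (act s (iact s y)) = sdrop n (iact s y)"
          using act_cofinal[of "iact s y" s] unfolding zeros_def by blast
        then show ?thesis using iact cof by (metis act_iact)
      qed
    qed
  qed
  have al: "a_line zeros" by (simp add: zeros_def)
  have al0: "a_line (False ## zeros)" using zeros al by metis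
  have sp: "splits s zeros" for s
    by (cases s) (use al al0 a_line_splits a_line_splits_b in auto)
  have "ended (card ({gen_a, gen_b} \<times> {1, - 1 :: int})) (schreier zeros)"
  proof (rule ended_card_index[where \<rho> = "\<lambda>(s, e). line_ray s zeros e" and Z = "{zeros}"])
    fix i j assume ij: "i \<in> {gen_a, gen_b} \<times> {1, - 1 :: int}" "j \<in> {gen_a, gen_b} \<times> {1, - 1 :: int}" "i \<noteq> j"
    obtain s e s' e' where i: "i = (s, e)" "j = (s', e')" by (cases i; cases j)
    have mixed: "\<not> tails_linked (schreier zeros) {zeros} (line_ray gen_a zeros e) (line_ray gen_b zeros e')"
      if e: "e \<in> {1, - 1}" for e e'
    proof
      assume "tails_linked (schreier zeros) {zeros} (line_ray gen_a zeros e) (line_ray gen_b zeros e')"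
      then obtain n where n: "path_within (- {zeros}) (line_ray gen_a zeros e n) (line_ray gen_b zeros e' n)"
        by (rule tails_linked_schreier)
      have "attach gen_a (line_ray gen_a zeros e n) = act_pow gen_a (e * (int n + 1)) zeros"
        using al by (simp add: line_ray_def attach_a_line)
      moreover have "attach gen_a (line_ray gen_b zeros e' n) = act_pow gen_a 0 zeros"
        using al by (simp add: line_ray_def attach_act_pow_b attach_a_line)
      ultimately show False
        using a_line_side[OF al n, of "e * (int n + 1)" 0] e by auto
    qed
    have "\<not> tails_linked (schreier zeros) {zeros} (line_ray s zeros e) (line_ray s' zeros e')"
    proof (cases "s = s'")
      case True
      then show ?thesis using splits_sep[OF sp] ij i by auto
    next
      case False
      then show ?thesis
        using mixed[of e e'] mixed[of e' e] ij i tails_linked_sym by (cases s; cases s') auto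
    qed
    then show "\<not> tails_linked (schreier zeros) {zeros} (case i of (s, e) \<Rightarrow> line_ray s zeros e) (case j of (s, e) \<Rightarrow> line_ray s zeros e)"
      using i by simp
  next
    fix S assume S: "finite S" "S \<subseteq> verts (schreier zeros)"
    have "\<forall>\<^sub>F k in sequentially. \<forall>y\<in>S. sdrop (2 * k) y \<in> {zeros, ?a, ?b}"
    proof (rule eventually_ball_finite[OF S(1)], rule ballI)
      fix y assume "y \<in> S"
      then obtain m where m: "sdrop (2 * m) y \<in> {zeros, ?a, ?b}" using orb_form S(2) by auto
      have "sdrop (2 * k) y \<in> {zeros, ?a, ?b}" if "k \<ge> m" for k
      proof -
        have "sdrop (2 * k) y = sdrop (2 * (k - m)) (sdrop (2 * m) y)" using that by (simp flip: distrib_left)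
        then show ?thesis using m a2 b2 o2k by (metis insert_iff singletonD)
      qed
      then show "\<forall>\<^sub>F k in sequentially. sdrop (2 * k) y \<in> {zeros, ?a, ?b}"
        unfolding eventually_sequentially by blast
    qed
    then obtain k where k: "\<forall>y\<in>S. sdrop (2 * k) y \<in> {zeros, ?a, ?b}"
      unfolding eventually_sequentially by blast
    \<comment> \<open>Removing \<open>b(a(0\<^sup>\<omega>))\<close> as well, a finite branch at \<open>a(0\<^sup>\<omega>)\<close>, leaves just the four ways
      along the lines.\<close>
    let ?F = "{zeros, ?a, ?b, ?ba}" and ?M = "{act gen_a ?a, iact gen_a zeros, act gen_b ?b, iact gen_b zeros}"
    show "\<exists>T N. finite T \<and> S \<subseteq> T \<and> T \<subseteq> verts (schreier zeros) \<and> finite N \<and>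
        card N \<le> card ({gen_a, gen_b} \<times> {1, - 1 :: int}) \<and>
        (\<forall>v\<in>verts (schreier zeros) - T. \<exists>u\<in>N. linked (schreier zeros) T v u)"
    proof (rule cover_tiles[where F = ?F and M = ?M and n = "2 * k"])
      show "card ?M \<le> card ({gen_a, gen_b} \<times> {1, - 1 :: int})"
        by (simp add: card_insert_if)
      fix x u assume x: "x \<in> ?F" "step x u" "u \<in> orb (sdrop (2 * k) zeros) - ?F"
      have bfix: "act gen_a ?b = ?b" "iact gen_a ?b = ?b" "act gen_a ?ba = ?ba" "iact gen_a ?ba = ?ba"
        using b ba by (metis act_SCons(2) iact_act)+
      have bb: "iact gen_b ?a = ?ba"
        by (subst a; subst b; simp add: ba)
      have bb': "act gen_b ?ba = ?a"
        by (subst ba; simp; metis a b)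
      obtain s where "u = act s x \<or> u = iact s x" using x(2) by (auto elim: stepE)
      then have "u \<in> ?M"
        using x(1,3) bfix bb bb' by (cases s) auto
      then show "\<exists>u'\<in>?M. path_within (orb (sdrop (2 * k) zeros) - ?F) u u'"
        by (rule bexI[rotated]) simp
    qed (use S k o2k in auto)
  qed (use sp line_ray in auto)
  moreover have "card ({gen_a, gen_b} \<times> {1, - 1 :: int}) = 4" by (simp add: card_insert_if)
  ultimately show ?thesis unfolding zeros_def by (simp only:)
qed

text \<open>
An infinite \<open>a\<close>-cycle at a tail can be pulled back to one at the word itself or one letter
further on, by prefixing zeros.
\<close>

lemma line_in_orb:
  assumes "a_line (sdrop n \<xi>)"
  shows "\<exists>x. a_line x \<and> (x \<in> orb \<xi> \<or> False ## x \<in> orb \<xi>)"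
  using assms
proof (induction n arbitrary: \<xi>)
  case 0
  then show ?case by (metis orb_refl sdrop.simps(1))
next
  case (Suc n)
  then obtain x where x: "a_line x" "x \<in> orb (stl \<xi>) \<or> False ## x \<in> orb (stl \<xi>)" by auto
  have lift: "False ## y \<in> orb \<xi>" if "y \<in> orb (stl \<xi>)" for y
    using orb_stl_iff[of "False ## y" \<xi>] that by simp
  show ?case
    using x lift[of x] lift[of "False ## x"] by (metis a_line_SCons2)
qed

lemma line_type:
  assumes "\<not> finite_cycles \<xi>"
  obtains x where "a_line x" "x \<in> orb \<xi> \<or> False ## x \<in> orb \<xi>"
  using assms line_in_orb unfolding finite_cycles_def a_line_def by blast

lemma schreier_cong: "y \<in> orb x \<Longrightarrow> schreier y = schreier x"
  by (simp add: schreier_def orb_eq)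

lemma infinite_cycle_two_ended:
  assumes "\<not> finite_cycles \<xi>" "sconst False \<notin> orb \<xi>"
  shows "ended 2 (schreier \<xi>)"
proof -
  obtain x where x: "a_line x" "x \<in> orb \<xi> \<or> False ## x \<in> orb \<xi>" using assms(1) by (rule line_type)
  have 1: "splits gen_a x" using x(1) by (rule a_line_splits)
  have 2: "splits gen_b (False ## x)" using x(1) by (intro a_line_splits_b) simp
  from x(2) show ?thesis
  proof
    assume "x \<in> orb \<xi>"
    then show ?thesis using splits_two_ended[OF 1] assms(2) by (simp add: orb_eq schreier_cong)
  next
    assume "False ## x \<in> orb \<xi>"
    then show ?thesis using splits_two_ended[OF 2] assms(2) by (simp add: orb_eq schreier_cong)
  qed
qed

lemma ended_unique: "ended k G \<Longrightarrow> ended l G \<Longrightarrow> k = l"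
  by (simp add: ended_def)

lemma ended_4_iff: "ended 4 (schreier \<xi>) \<longleftrightarrow> sconst False \<in> orb \<xi>"
proof
  assume 4: "ended 4 (schreier \<xi>)"
  show "sconst False \<in> orb \<xi>"
  proof (rule ccontr)
    assume "sconst False \<notin> orb \<xi>"
    then have "ended 1 (schreier \<xi>) \<or> ended 2 (schreier \<xi>)"
      using finite_cycles_one_ended infinite_cycle_two_ended by blast
    then show False using ended_unique[OF 4, of 1] ended_unique[OF 4, of 2] by auto
  qed
next
  assume "sconst False \<in> orb \<xi>"
  then show "ended 4 (schreier \<xi>)" using zeros_four_ended schreier_cong by metis
qed

lemma ended_1_iff: "ended 1 (schreier \<xi>) \<longleftrightarrow> finite_cycles \<xi>"
proof
  assume 1: "ended 1 (schreier \<xi>)"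
  show "finite_cycles \<xi>"
  proof (rule ccontr)
    assume "\<not> finite_cycles \<xi>"
    then have "ended 4 (schreier \<xi>) \<or> ended 2 (schreier \<xi>)"
      using ended_4_iff infinite_cycle_two_ended by blast
    then show False using ended_unique[OF 1, of 4] ended_unique[OF 1, of 2] by auto
  qed
qed (rule finite_cycles_one_ended)

lemma ended_2_iff: "ended 2 (schreier \<xi>) \<longleftrightarrow> \<not> finite_cycles \<xi> \<and> sconst False \<notin> orb \<xi>"
proof
  assume 2: "ended 2 (schreier \<xi>)"
  have "\<not> ended 1 (schreier \<xi>)" using ended_unique[OF 2, of 1] by auto
  moreover have "\<not> ended 4 (schreier \<xi>)" using ended_unique[OF 2, of 4] by auto
  ultimately show "\<not> finite_cycles \<xi> \<and> sconst False \<notin> orb \<xi>"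
    using ended_4_iff ended_1_iff by blast
qed (use infinite_cycle_two_ended in blast)

section \<open>Uncountably many reversals\<close>

text \<open>
Cantor's diagonal argument.
\<close>

lemma uncountable_predicates: "uncountable (UNIV :: (nat \<Rightarrow> bool) set)"
proof
  assume "countable (UNIV :: (nat \<Rightarrow> bool) set)"
  define e where "e = from_nat_into (UNIV :: (nat \<Rightarrow> bool) set)"
  have "range e = UNIV"
    unfolding e_def by (rule range_from_nat_into) (simp, fact)
  then have "(\<lambda>m. \<not> e m m) \<in> range e" by simp
  then obtain n where "(\<lambda>m. \<not> e m m) = e n" by (rule rangeE)
  then have "(\<not> e n n) = e n n" by (rule fun_cong)
  then show False by simp
qed

text \<open>
If \<open>w = 0 i u\<close>, the correction by \<open>a\<^sup>-\<^sup>1\<close> behind the leading \<open>1\<close> replaces \<open>i\<close> by the other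
letter, and nothing that follows alters it again. So the image shows whether the correction
took place.
\<close>

lemma twist_decision:
  assumes "twist f (True ## w) = twist g (True ## w)" "\<not> shd w"
  shows "flip (f \<circ> Suc) w = flip (g \<circ> Suc) w"
proof -
  obtain i u where w: "w = False ## i ## u"
    using assms(2) by (cases w rule: two_letters) auto
  have "twist f (True ## w) !! 2 = (i \<noteq> flip (f \<circ> Suc) w)" for f
    unfolding w numeral_2_eq_2 by (cases i) auto
  then show ?thesis using assms(1) by metis
qed

text \<open>
The letter behind a factor \<open>10\<close> of the image reveals whether the corresponding cycle was
reversed. Hence \<open>x\<close> and its image determine \<open>f\<close> at all positions where the odometer that
starts behind the \<open>1\<close> of such a factor is cut off.
\<close>

lemma twist_determined:
  assumes "twist f x = y" "twist g x = y" "y !! n" "\<not> y !! Suc n" "cycle_rank k (sdrop (Suc n) y)"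
  shows "f (Suc n + 2 * k) = g (Suc n + 2 * k)"
  using assms
proof (induction n arbitrary: f g x y)
  case 0
  have "shd x" using 0 by auto
  then obtain w where x: "x = True ## w" by (cases x) auto
  let ?w = "if flip (f \<circ> Suc) w then iact gen_a w else w"
  have y: "stl y = twist (f \<circ> Suc) ?w" using 0(1) x by auto
  have "\<not> shd w" using 0(4) y by (simp split: if_splits)
  then have eq: "flip (f \<circ> Suc) w = flip (g \<circ> Suc) w"
    using twist_decision[of f w g] 0(1,2) unfolding x by metis
  have "cycle_rank k w" using 0(5) y by (simp split: if_splits)
  then show ?case using eq by (simp add: flip_cycle_rank)
next
  case (Suc n)
  obtain i w where x: "x = i ## w" by (cases x)
  let ?t = "\<lambda>f. if i \<and> flip (f \<circ> Suc) w then iact gen_a w else w"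
  have tw: "twist f x = i ## twist (f \<circ> Suc) (?t f)" for f
    unfolding x by (cases i) auto
  have st: "stl (twist f x) = twist (f \<circ> Suc) (?t f)" for f
    unfolding tw by (rule stream.sel(2))
  have same: "?t f = ?t g"
  proof (cases "i \<and> \<not> shd w")
    case True
    then have "twist f (True ## w) = twist g (True ## w)" using Suc.prems(1,2) x by simp
    then have "flip (f \<circ> Suc) w = flip (g \<circ> Suc) w" using True by (intro twist_decision) simp_all
    then show ?thesis by simp
  next
    case False
    then have "i \<Longrightarrow> iact gen_a w = w" by (metis act_a_fixed_iff iact_act)
    then show ?thesis by auto
  qed
  have "twist (f \<circ> Suc) (?t f) = stl y"
    using st[of f] unfolding Suc.prems(1) by (rule sym)
  moreover have "twist (g \<circ> Suc) (?t f) = stl y"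
    using st[of g] unfolding Suc.prems(2) same by (rule sym)
  moreover have "stl y !! n" "\<not> stl y !! Suc n" "cycle_rank k (sdrop (Suc n) (stl y))"
    using Suc.prems(3-5) by simp_all
  ultimately have "(f \<circ> Suc) (Suc n + 2 * k) = (g \<circ> Suc) (Suc n + 2 * k)"
    by (rule Suc.IH)
  then show ?case by simp
qed

lemma finite_cycles_twist: "finite_cycles x \<Longrightarrow> finite_cycles (twist f x)"
  unfolding finite_cycles_def
proof
  fix n show "\<exists>k. cycle_rank k (sdrop n (twist f x))" if "\<forall>n. \<exists>k. cycle_rank k (sdrop n x)"
    using that[folded finite_cycles_def]
  proof (induction n arbitrary: f x)
    case 0
    then show ?case using finite_cycles_cycle_rank by simp
  next
    case (Suc n)
    then show ?case
      using Suc.IH[of "if shd x \<and> flip (f \<circ> Suc) (stl x) then iact gen_a (stl x) else stl x" "f \<circ> Suc"]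
      by simp
  qed
qed

lemma eq_onesI: "(\<And>n. x !! n) \<Longrightarrow> x = sconst True"
  by (rule stream_eqI) simp

lemma stl_sconst: "stl (sconst c) = sconst c"
  by simp

lemma twist_ones:
  assumes "twist f x = sconst True" shows "x = sconst True"
proof (rule eq_onesI)
  fix n show "x !! n" using assms
  proof (induction n arbitrary: f x)
    case 0
    then have "shd (twist f x)" by simp
    then show ?case by simp
  next
    case (Suc n)
    have "shd (twist f x)" using Suc.prems by simp
    then obtain w where x: "x = True ## w" by (cases x) auto
    let ?t = "if flip (f \<circ> Suc) w then iact gen_a w else w"
    have tw: "twist (f \<circ> Suc) ?t = sconst True"
    proof -
      have "stl (twist f x) = sconst True" unfolding Suc.prems by (rule stl_sconst)
      then show ?thesis unfolding x twist_SCons stream.sel .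
    qed
    then have "shd (twist (f \<circ> Suc) ?t)" by (simp del: twist.simps)
    then have "shd w" by (simp split: if_splits)
    then have "?t = w" by (metis act_a_fixed_iff iact_act)
    then have "w !! n" using Suc.IH[of "f \<circ> Suc" w] tw by argo
    then show ?case by (simp add: x)
  qed
qed

text \<open>
A word with infinitely many \<open>0\<close>s and \<open>1\<close>s contains the factor \<open>10\<close> infinitely often; the
odometer behind its \<open>1\<close> is cut off because all cycles are finite.
\<close>

lemma decisions_unbounded:
  assumes "finite_cycles y" "y \<notin> orb (sconst True)"
  shows "\<exists>n k. m \<le> n \<and> y !! n \<and> \<not> y !! Suc n \<and> cycle_rank k (sdrop (Suc n) y)"
proof -
  have "sconst False \<notin> orb y" using assms(1) finite_cycles_orb not_finite_cycles_zeros by blast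
  then obtain p where p: "p \<ge> m" "shd (sdrop p y)" using frequently_True by blast
  have "sdrop p y \<noteq> sconst True" using assms(2) cofinal_orb[of p y "sconst True"] by auto
  then have "\<exists>d. \<not> sdrop p y !! d" using stream_eqI[of "sdrop p y" "sconst True"] by auto
  then obtain d where d: "\<not> sdrop p y !! d" "\<And>e. e < d \<Longrightarrow> sdrop p y !! e"
    using exists_least_iff[of "\<lambda>d. \<not> sdrop p y !! d"] by blast
  obtain e where e: "d = Suc e" using d(1) p(2) by (cases d) auto
  obtain k where "cycle_rank k (sdrop (Suc (p + e)) y)" using assms(1) unfolding finite_cycles_def by blast
  moreover have "y !! (p + e)" "\<not> y !! Suc (p + e)"
    using d(2)[of e] d(1) e by (simp_all add: sdrop_snth add.commute)
  ultimately show ?thesis using p(1) by (intro exI[of _ "p + e"] exI[of _ k]) auto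
qed

text \<open>
Diagonal argument: given a list \<open>e\<close> of images, choose for each \<open>e i\<close> a position \<open>m i\<close>, all
different, at which \<open>e i\<close> determines the function that produced it, and let \<open>g\<close> disagree
there.
\<close>

lemma uncountable_twists:
  assumes "finite_cycles \<xi>" "\<xi> \<notin> orb (sconst True)"
  shows "uncountable (range (\<lambda>f. twist f \<xi>))"
proof
  let ?R = "range (\<lambda>f. twist f \<xi>)"
  assume "countable ?R"
  define e where "e = from_nat_into ?R"
  have e: "?R = range e"
    unfolding e_def using \<open>countable ?R\<close> by (intro range_from_nat_into[symmetric]) auto
  have "\<forall>i. \<exists>f. e i = twist f \<xi>" using e by blast
  then have "\<exists>h. \<forall>i. e i = twist (h i) \<xi>" by (rule choice)
  then obtain h where h: "\<And>i. e i = twist (h i) \<xi>" by blast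
  \<comment> \<open>The positions at which \<open>e i\<close> determines the function it comes from.\<close>
  define M where "M i = {Suc n + 2 * k | n k. e i !! n \<and> \<not> e i !! Suc n \<and> cycle_rank k (sdrop (Suc n) (e i))}" for i
  have unb: "\<exists>p\<in>M i. m < p" for i m
  proof -
    have "e i \<notin> orb (sconst True)"
    proof
      assume "e i \<in> orb (sconst True)"
      then have "sconst True \<in> orb (twist (h i) \<xi>)" using h orb_sym by metis
      then obtain y where y: "y \<in> orb \<xi>" "sconst True = twist (h i) y" by (rule twist_orbE)
      then have "y = sconst True" using twist_ones by metis
      then show False using y assms(2) orb_sym by blast
    qed
    moreover have "finite_cycles (e i)" unfolding h using assms(1) by (rule finite_cycles_twist)
    ultimately obtain n k where "m \<le> n" "e i !! n" "\<not> e i !! Suc n" "cycle_rank k (sdrop (Suc n) (e i))"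
      using decisions_unbounded by blast
    then show ?thesis unfolding M_def by (intro bexI[of _ "Suc n + 2 * k"]) auto
  qed
  have "\<exists>m. \<forall>i. m i \<in> M i \<and> m i < m (Suc i)"
  proof (rule dependent_nat_choice)
    show "\<exists>p. p \<in> M 0" using unb by blast
    show "\<exists>q. q \<in> M (Suc i) \<and> p < q" if "p \<in> M i" for p i using unb by blast
  qed
  then obtain m :: "nat \<Rightarrow> nat" where m: "\<And>i. m i \<in> M i" "\<And>i. m i < m (Suc i)" by blast
  have "strict_mono m" using m(2) by (rule strict_mono_Suc_iff[THEN iffD2, rule_format])
  then have inj: "m i = m j \<longleftrightarrow> i = j" for i j by (rule strict_mono_eq)
  define g where "g p \<longleftrightarrow> (\<exists>i. p = m i \<and> \<not> h i p)" for p
  have g: "g (m i) = (\<not> h i (m i))" for i unfolding g_def inj by auto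
  have "twist g \<xi> \<in> ?R" by blast
  then obtain j where j: "twist g \<xi> = e j" using e by auto
  obtain n k where n: "m j = Suc n + 2 * k" "e j !! n" "\<not> e j !! Suc n" "cycle_rank k (sdrop (Suc n) (e j))"
    using m(1)[of j] unfolding M_def by blast
  have "g (m j) = h j (m j)"
    unfolding n(1) by (rule twist_determined[OF j h[symmetric] n(2-4)])
  then show False using g by simp
qed

section \<open>Rigidity of words under isomorphisms\<close>

text \<open>
Words that match under some isomorphism, whatever the orbits; this forgets the map and keeps
what is needed to compare the words letter by letter.
\<close>

definition corresponds :: "binword \<Rightarrow> binword \<Rightarrow> bool" where
  "corresponds x y \<longleftrightarrow> (\<exists>f U. label_iso f U \<and> x \<in> U \<and> f x = y)"

lemma corresponds_False: "corresponds (False ## w) y \<Longrightarrow> \<exists>w'. y = False ## w' \<and> corresponds w w'"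
  unfolding corresponds_def using label_iso_stl(1,2) by fastforce

lemma corresponds_True:
  assumes "corresponds (True ## w) y"
  shows "\<exists>w'. y = True ## w' \<and> (corresponds w w' \<or> corresponds (iact gen_a w) w')"
proof -
  obtain f U where f: "label_iso f U" "True ## w \<in> U" "f (True ## w) = y"
    using assms unfolding corresponds_def by blast
  define g V where "g = (\<lambda>w. stl (f (False ## w)))" and "V = {w. False ## w \<in> U}"
  have g: "label_iso g V" using label_iso_stl(1)[OF f(1)] by (simp add: g_def V_def)
  have w: "w \<in> V" using label_isoD(1)[OF f(1,2), of gen_b] by (simp add: V_def)
  have "y = True ## g w \<or> y = True ## g (iact gen_a w)"
    using label_iso_stl(3)[OF f(1,2)] f(3) by (simp add: g_def)
  then show ?thesis
    using g w label_isoD(2)[OF g w, of gen_a] unfolding corresponds_def by blast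
qed

lemma corresponds_True_True: "corresponds (True ## True ## w) y \<Longrightarrow> \<exists>w'. y = True ## w' \<and> corresponds (True ## w) w'"
  using corresponds_True[of "True ## w" y] by simp

text \<open>
Behind each letter \<open>1\<close> the tail is \<open>1\<^sup>\<omega>\<close>, which \<open>a\<close> fixes, so there is never a choice.
\<close>

lemma corresponds_ones:
  assumes "corresponds (sconst True) y" shows "y = sconst True"
proof (rule eq_onesI)
  fix n show "y !! n" using assms
  proof (induction n arbitrary: y)
    case 0
    then have "corresponds (True ## sconst True) y" by (metis sconst_SCons)
    then show ?case using corresponds_True by fastforce
  next
    case (Suc n)
    then have "corresponds (True ## True ## sconst True) y" by (metis sconst_SCons)
    then obtain w where w: "y = True ## w" "corresponds (True ## sconst True) w" using corresponds_True_True by blast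
    have "corresponds (sconst True) w" using w(2) by (metis sconst_SCons)
    then have "w !! n" by (rule Suc.IH)
    then show ?case using w(1) by simp
  qed
qed

lemma corresponds_isomorphic:
  assumes "isomorphic (schreier x) (schreier y)"
  obtains z where "corresponds x z" "z \<in> orb y"
proof -
  obtain f where f: "label_iso f (orb x)" "f ` orb x = orb y"
    using assms by (rule label_iso_of_isomorphic)
  then have "corresponds x (f x)" unfolding corresponds_def using orb_refl by blast
  then show thesis using that f(2) orb_refl by blast
qed

text \<open>
The predicate \<open>A\<close> is written on the multiples of \<open>3\<close>, with \<open>A n\<close> marked by a \<open>0\<close>, and all
other letters are \<open>1\<close>. With this spacing reversals of cycles can alter only the letter
directly behind a mark.
\<close>

definition marked :: "(nat \<Rightarrow> bool) \<Rightarrow> binword" where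
  "marked A = smap (\<lambda>n. \<not> (3 dvd n \<and> A (n div 3))) nats"

lemma marked_snth: "marked A !! n \<longleftrightarrow> \<not> (3 dvd n \<and> A (n div 3))"
  by (simp add: marked_def)

lemma marked_SCons: "marked A = (\<not> A 0) ## True ## True ## marked (A \<circ> Suc)"
proof (rule stream_eqI)
  fix n :: nat
  have m: "marked A !! 0 = (\<not> A 0)" "marked A !! 1" "marked A !! 2"
    unfolding marked_snth by simp_all
  consider "n = 0" | "n = 1" | "n = 2" | k where "n = k + 3"
  proof -
    have "n < 3 \<or> (\<exists>k. n = k + 3)" by presburger
    then show thesis using that by (auto simp: numeral_3_eq_3 numeral_2_eq_2 less_Suc_eq)
  qed
  then show "marked A !! n = ((\<not> A 0) ## True ## True ## marked (A \<circ> Suc)) !! n"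
  proof cases
    case (4 k)
    then have n: "n = Suc (Suc (Suc k))" by simp
    have "3 dvd n \<longleftrightarrow> 3 dvd k" "n div 3 = Suc (k div 3)" using 4 by auto
    then have "marked A !! n = marked (A \<circ> Suc) !! k" unfolding marked_snth by simp
    then show ?thesis by (simp only: n snth.simps stream.sel)
  qed (use m in \<open>auto simp: numeral_2_eq_2\<close>)
qed

lemma finite_cycles_marked: "finite_cycles (marked A)"
  unfolding finite_cycles_def
proof
  fix n
  show "\<exists>k. cycle_rank k (sdrop n (marked A))"
  proof (cases "marked A !! n")
    case True
    then have "cycle_rank 0 (sdrop n (marked A))" by simp
    then show ?thesis ..
  next
    case False
    then have "3 dvd n" by (simp add: marked_snth)
    then have "\<not> 3 dvd Suc (Suc n)" by presburger
    then have "marked A !! Suc (Suc n)" unfolding marked_snth by blast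
    then have "cycle_rank (Suc 0) (sdrop n (marked A))"
      using False unfolding cycle_rank.simps sdrop_simps by blast
    then show ?thesis ..
  qed
qed

text \<open>
In each block \<open>c 1 1\<close> the middle letter may have been altered if \<open>c = 0\<close>, so the induction
treats blocks \<open>c i 1\<close>. The only possible correction, behind the third letter, changes the
next block \<open>0 1 1\<close> to \<open>0 0 1\<close> and goes no further.
\<close>

lemma corresponds_marked:
  assumes "corresponds (c ## i ## True ## marked A) y" "c \<longrightarrow> i"
  shows "y !! (3 * n) = (case n of 0 \<Rightarrow> c | Suc m \<Rightarrow> \<not> A m)"
  using assms
proof (induction n arbitrary: c i A y)
  case 0
  then show ?case using corresponds_False corresponds_True by (cases c) fastforce+
next
  case (Suc n)
  have "\<exists>y1. y = c ## y1 \<and> corresponds (i ## True ## marked A) y1"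
    using Suc.prems corresponds_False corresponds_True_True by (cases c) auto
  then obtain y1 where y1: "y = c ## y1" "corresponds (i ## True ## marked A) y1" by blast
  then have "\<exists>y2. y1 = i ## y2 \<and> corresponds (True ## marked A) y2"
    using corresponds_False corresponds_True_True by (cases i) auto
  then obtain y2 where y2: "y1 = i ## y2" "corresponds (True ## marked A) y2" by blast
  then obtain y3 where y3: "y2 = True ## y3" "corresponds (marked A) y3 \<or> corresponds (iact gen_a (marked A)) y3"
    using corresponds_True by blast
  have "\<exists>i'. (\<not> A 0 \<longrightarrow> i') \<and> corresponds ((\<not> A 0) ## i' ## True ## marked (A \<circ> Suc)) y3"
    using y3(2)
  proof
    assume "corresponds (marked A) y3"
    then show ?thesis by (metis marked_SCons)
  next
    assume "corresponds (iact gen_a (marked A)) y3"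
    moreover have "iact gen_a (marked A) = (\<not> A 0) ## (\<not> A 0) ## True ## marked (A \<circ> Suc)"
      by (subst marked_SCons) (cases "A 0"; simp)
    ultimately show ?thesis by metis
  qed
  then obtain i' where "\<not> A 0 \<longrightarrow> i'" "corresponds ((\<not> A 0) ## i' ## True ## marked (A \<circ> Suc)) y3" by blast
  then have "y3 !! (3 * n) = (case n of 0 \<Rightarrow> \<not> A 0 | Suc m \<Rightarrow> \<not> (A \<circ> Suc) m)"
    using Suc.IH by blast
  moreover have "3 * Suc n = Suc (Suc (Suc (3 * n)))" by simp
  ultimately show ?case unfolding y1(1) y2(1) y3(1) by (simp split: nat.splits del: mult_Suc_right)
qed

lemma corresponds_marked_decode: "corresponds (marked A) y \<Longrightarrow> A = (\<lambda>n. \<not> y !! (3 * n))"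
proof
  fix n assume "corresponds (marked A) y"
  then have "corresponds ((\<not> A 0) ## True ## True ## marked (A \<circ> Suc)) y" by (metis marked_SCons)
  then show "A n = (\<not> y !! (3 * n))"
    using corresponds_marked[of "\<not> A 0" True "A \<circ> Suc" y n] by (simp split: nat.splits)
qed

section \<open>Orbits in an isomorphism class\<close>

lemma isomorphic_refl: "isomorphic G G"
  unfolding isomorphic_def by (intro exI[of _ id]) auto

lemma iso_class_refl [simp]: "\<xi> \<in> iso_class \<xi>"
  by (simp add: iso_class_def isomorphic_refl)

lemma iso_class_cong: "\<eta> \<in> orb \<xi> \<Longrightarrow> iso_class \<eta> = iso_class \<xi>"
  unfolding iso_class_def by (simp add: schreier_cong)

lemma iso_class_orb: "\<eta> \<in> iso_class \<xi> \<Longrightarrow> \<zeta> \<in> orb \<eta> \<Longrightarrow> \<zeta> \<in> iso_class \<xi>"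
  unfolding iso_class_def by (simp add: schreier_cong)

lemma orbits_in_iso_class: "orbits_in (iso_class \<xi>) = orb ` iso_class \<xi>"
proof -
  have "orbits basilica UNIV (\<lambda>g. g) = range orb" by (auto simp: orbits_def)
  then show ?thesis
    unfolding orbits_in_def using iso_class_orb orb_refl by (auto intro!: imageI)
qed

text \<open>
Representatives \<open>x\<close> and \<open>0 x\<close> cover infinite \<open>a\<close>-cycles and infinite \<open>b\<close>-cycles.
\<close>

lemma iso_class_a_line:
  assumes "a_line x" "r = x \<or> r = False ## x"
  shows "iso_class r = orb r \<union> orb (tau r)"
proof (intro equalityI subsetI)
  fix y assume "y \<in> iso_class r"
  then have "isomorphic (schreier r) (schreier y)" by (simp add: iso_class_def)
  then obtain f where f: "label_iso f (orb r)" "f ` orb r = orb y"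
    by (rule label_iso_of_isomorphic)
  have "f r = r \<or> f r = tau r"
    using assms(2) label_iso_a_line[OF f(1) _ assms(1)] label_iso_a_line_b[OF f(1) _ assms(1)] by auto
  moreover have "f r \<in> orb y" using f(2) orb_refl by blast
  ultimately have "r \<in> orb y \<or> tau r \<in> orb y" by auto
  then show "y \<in> orb r \<union> orb (tau r)" using orb_sym by blast
next
  fix y assume "y \<in> orb r \<union> orb (tau r)"
  moreover have "tau r \<in> iso_class r" unfolding iso_class_def using isomorphic_twist by blast
  ultimately show "y \<in> iso_class r" using iso_class_orb iso_class_refl by blast
qed

lemma orbits_in_a_line:
  assumes "a_line x" "r = x \<or> r = False ## x"
  shows "orbits_in (iso_class r) = {orb r, orb (tau r)}"
proof -
  have "orbits_in (iso_class r) = orb ` (orb r \<union> orb (tau r))"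
    using orbits_in_iso_class[of r] iso_class_a_line[OF assms] by simp
  also have "\<dots> = {orb r, orb (tau r)}"
  proof (intro equalityI subsetI)
    fix A assume "A \<in> orb ` (orb r \<union> orb (tau r))"
    then show "A \<in> {orb r, orb (tau r)}" by (auto dest: orb_eq)
  next
    fix A assume "A \<in> {orb r, orb (tau r)}"
    then show "A \<in> orb ` (orb r \<union> orb (tau r))" using orb_refl by blast
  qed
  finally show ?thesis .
qed

lemma tau_zeros: "tau (sconst False) = sconst False"
proof -
  have "tau (False ## sconst False) = False ## tau (sconst False)" by simp
  then have eq: "tau (sconst False) = False ## tau (sconst False)" by (metis sconst_SCons)
  have "tau (sconst False) = tau (sconst False)" ..
  then show ?thesis
  proof (rule eq_zerosI[of "\<lambda>y. y = tau (sconst False)"])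
    fix y assume y: "y = tau (sconst False)"
    have "\<not> shd (tau (sconst False))" "stl (tau (sconst False)) = tau (sconst False)"
      using eq by (metis stream.sel)+
    then show "\<not> shd y \<and> stl y = tau (sconst False)" unfolding y by blast
  qed
qed

lemma four_ended_class: "ended_classes 4 = {iso_class (sconst False)}"
proof -
  have "iso_class \<xi> = iso_class (sconst False)" if "sconst False \<in> orb \<xi>" for \<xi>
    using iso_class_cong[OF that] by simp
  moreover have "sconst False \<in> orb (sconst False)" by simp
  ultimately show ?thesis unfolding ended_classes_def ended_4_iff by blast
qed

lemma four_ended_orbits: "card (orbits_in (iso_class (sconst False))) = 1"
  using orbits_in_a_line[OF a_line_zeros, of "sconst False"] by (simp add: tau_zeros)

lemma two_ended_orbits:
  assumes "C \<in> ended_classes 2"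
  shows "card (orbits_in C) = 2"
proof -
  obtain \<xi> where \<xi>: "C = iso_class \<xi>" "\<not> finite_cycles \<xi>" "sconst False \<notin> orb \<xi>"
    using assms unfolding ended_classes_def ended_2_iff by blast
  obtain x where x: "a_line x" "x \<in> orb \<xi> \<or> False ## x \<in> orb \<xi>"
    using \<xi>(2) by (rule line_type)
  then obtain r where r: "r = x \<or> r = False ## x" "r \<in> orb \<xi>" by blast
  have C: "orbits_in C = {orb r, orb (tau r)}"
    unfolding \<xi>(1) iso_class_cong[OF r(2), symmetric] using x(1) r(1) by (rule orbits_in_a_line)
  have z: "sconst False \<notin> orb r" using \<xi>(3) orb_eq[OF r(2)] by simp
  have "tau r \<notin> orb r"
    using r(1)
  proof
    assume "r = x"
    then show ?thesis using tau_notin_orb x(1) z by simp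
  next
    assume rx: "r = False ## x"
    have "sconst False \<notin> orb x"
      using z orb_stl_iff[of "sconst False" r] by (simp add: rx)
    then have "tau x \<notin> orb x" using tau_notin_orb x(1) by blast
    then show ?thesis using orb_stl_iff[of "tau r" r] by (simp add: rx)
  qed
  then have "orb (tau r) \<noteq> orb r" using orb_refl by metis
  then show ?thesis unfolding C by simp
qed

text \<open>
The digits of an arbitrary 2-adic integer, spread over the odd positions.
\<close>

definition even_zeros :: "(nat \<Rightarrow> bool) \<Rightarrow> binword" where
  "even_zeros A = smap (\<lambda>n. odd n \<and> A (n div 2)) nats"

lemma cycle_rank_snth: "cycle_rank k x \<Longrightarrow> x !! (2 * k)"
  by (induction k arbitrary: x) auto

lemma a_line_even_zeros: "a_line (even_zeros A)"
  unfolding a_line_def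
proof (intro allI notI)
  fix k assume "cycle_rank k (even_zeros A)"
  then have "even_zeros A !! (2 * k)" by (rule cycle_rank_snth)
  then show False by (simp add: even_zeros_def)
qed

lemma inj_even_zeros: "inj even_zeros"
proof (rule injI)
  fix A B assume eq: "even_zeros A = even_zeros B"
  have dec: "even_zeros A !! (2 * n + 1) = A n" for A n by (simp add: even_zeros_def)
  show "A = B"
  proof
    fix n show "A n = B n" using dec[of A n] dec[of B n] unfolding eq by blast
  qed
qed

lemma countable_class:
  assumes "countable (orbits_in (iso_class \<xi>))"
  shows "countable (iso_class \<xi>)"
proof -
  have "countable A" if "A \<in> orbits_in (iso_class \<xi>)" for A
    using that countable_orb unfolding orbits_in_iso_class by blast
  then show ?thesis
    using assms countable_UN[of "orbits_in (iso_class \<xi>)" "\<lambda>A. A"]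
    by (subst iso_class_Union_orbits) simp
qed

text \<open>
Each class is countable, being two orbits, but there are uncountably many words on infinite
\<open>a\<close>-cycles.
\<close>

lemma uncountable_two_ended: "uncountable (ended_classes 2)"
proof
  assume cnt: "countable (ended_classes 2)"
  have "countable C" if "C \<in> ended_classes 2" for C
  proof -
    have "finite (orbits_in C)"
      using two_ended_orbits[OF that] by (metis card.infinite zero_neq_numeral)
    then show ?thesis using that countable_class countable_finite unfolding ended_classes_def by blast
  qed
  then have "countable (\<Union> (ended_classes 2) \<union> orb (sconst False))"
    using cnt countable_orb countable_UN[of "ended_classes 2" "\<lambda>C. C"] by simp
  moreover have "range even_zeros \<subseteq> \<Union> (ended_classes 2) \<union> orb (sconst False)"
  proof
    fix x assume "x \<in> range even_zeros"
    then have "\<not> finite_cycles x" using a_line_even_zeros finite_cycles_cycle_rank unfolding a_line_def by blast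
    then have "x \<in> iso_class x \<and> iso_class x \<in> ended_classes 2 \<or> x \<in> orb (sconst False)"
      using orb_sym unfolding ended_classes_def ended_2_iff by auto
    then show "x \<in> \<Union> (ended_classes 2) \<union> orb (sconst False)" by blast
  qed
  ultimately have "countable (range even_zeros)" by (rule countable_subset[rotated])
  then show False
    using inj_even_zeros uncountable_predicates countable_image_inj_eq by blast
qed

text \<open>
Here the classes are uncountable, so an invariant is needed: a class contains only countably
many words \<open>marked A\<close>, because \<open>A\<close> can be read from a word in the orbit of any other word
\<open>marked B\<close> of the class.
\<close>

lemma uncountable_one_ended: "uncountable (ended_classes 1)"
proof
  assume cnt: "countable (ended_classes 1)"
  let ?F = "\<lambda>D. {A. iso_class (marked A) = D}"
  have "countable (?F D)" for D
  proof (cases "?F D = {}")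
    case False
    then obtain B where B: "iso_class (marked B) = D" by blast
    have "A \<in> (\<lambda>y n. \<not> y !! (3 * n)) ` orb (marked B)" if "A \<in> ?F D" for A
    proof -
      have "marked B \<in> iso_class (marked A)" using that B by (metis iso_class_refl mem_Collect_eq)
      then have "isomorphic (schreier (marked A)) (schreier (marked B))" by (simp add: iso_class_def)
      then obtain z where "corresponds (marked A) z" "z \<in> orb (marked B)" by (rule corresponds_isomorphic)
      then show ?thesis using corresponds_marked_decode by blast
    qed
    then have "?F D \<subseteq> (\<lambda>y n. \<not> y !! (3 * n)) ` orb (marked B)" by blast
    then show ?thesis using countable_orb countable_image countable_subset by metis
  qed simp
  then have "countable (\<Union>D\<in>ended_classes 1. ?F D)" using cnt by (intro countable_UN)
  moreover have "iso_class (marked A) \<in> ended_classes 1" for A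
    unfolding ended_classes_def ended_1_iff using finite_cycles_marked by blast
  then have "(\<Union>D\<in>ended_classes 1. ?F D) = UNIV" by blast
  ultimately show False using uncountable_predicates by simp
qed

lemma finite_cycles_ones: "finite_cycles (sconst True)"
  unfolding finite_cycles_def by (metis cycle_rank.simps(1) sdrop_sconst siterate.simps(1))

lemma ones_class: "orbits_in (iso_class (sconst True)) = {orb (sconst True)}"
proof -
  have "orb y = orb (sconst True)" if "y \<in> iso_class (sconst True)" for y
  proof -
    have "isomorphic (schreier (sconst True)) (schreier y)" using that by (simp add: iso_class_def)
    then obtain z where "corresponds (sconst True) z" "z \<in> orb y" by (rule corresponds_isomorphic)
    then have "sconst True \<in> orb y" using corresponds_ones by blast
    then show ?thesis by (simp add: orb_eq)
  qed
  then show ?thesis unfolding orbits_in_iso_class using iso_class_refl by blast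
qed

lemma one_ended_orbits:
  assumes "C \<in> ended_classes 1" "C \<noteq> iso_class (sconst True)"
  shows "uncountable (orbits_in C)"
proof
  assume cnt: "countable (orbits_in C)"
  obtain \<xi> where \<xi>: "C = iso_class \<xi>" "finite_cycles \<xi>"
    using assms(1) unfolding ended_classes_def ended_1_iff by blast
  then have "\<xi> \<notin> orb (sconst True)" using assms(2) iso_class_cong by blast
  then have "uncountable (range (\<lambda>f. twist f \<xi>))" using \<xi>(2) by (intro uncountable_twists)
  moreover have "range (\<lambda>f. twist f \<xi>) \<subseteq> C"
    unfolding \<xi>(1) iso_class_def using isomorphic_twist by blast
  moreover have "countable C" using cnt countable_class \<xi>(1) by blast
  ultimately show False using countable_subset by blast
qed

theorem corollary4p2:
  shows "(\<exists>C. ended_classes 4 = {C} \<and> card (orbits_in C) = 1) \<and>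
    (uncountable (ended_classes 2) \<and>
      (\<forall>C\<in>ended_classes 2. card (orbits_in C) = 2)) \<and>
    (uncountable (ended_classes 1) \<and>
      iso_class (sconst True) \<in> ended_classes 1 \<and>
      card (orbits_in (iso_class (sconst True))) = 1 \<and>
      (\<forall>C\<in>ended_classes 1. C \<noteq> iso_class (sconst True) \<longrightarrow> uncountable (orbits_in C)))"
proof (intro conjI ballI impI)
  show "\<exists>C. ended_classes 4 = {C} \<and> card (orbits_in C) = 1"
    using four_ended_class four_ended_orbits by blast
  show "iso_class (sconst True) \<in> ended_classes 1"
    unfolding ended_classes_def ended_1_iff using finite_cycles_ones by blast
  show "card (orbits_in (iso_class (sconst True))) = 1"
    by (simp add: ones_class)
  show "uncountable (ended_classes 2)" by (rule uncountable_two_ended)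
  show "uncountable (ended_classes 1)" by (rule uncountable_one_ended)
  show "card (orbits_in C) = 2" if "C \<in> ended_classes 2" for C
    using that by (rule two_ended_orbits)
  show "uncountable (orbits_in C)" if "C \<in> ended_classes 1" "C \<noteq> iso_class (sconst True)" for C
    using that by (rule one_ended_orbits)
qed

end
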